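(* Let $\varepsilon:\mathbb{R}\to\mathbb{R}$ be a function that is not $C^1$ and that is $\frac{1}{4\pi}$-Lipschitz. Then the function $$u(\theta,c)=\frac{\varepsilon(c)}{2\pi}\sin(2\pi\theta)$$ is the generating function of a foliation of $\mathbb{A}$ into smooth graphs of $\theta\in\mathbb{T}\mapsto c+\varepsilon(c)\cos(2\pi\theta)$ ($c\in\mathbb{R}$), and this foliation is invariant by no $C^0$-integrable symplectic twist diffeomorphism of $\mathbb{A}$.
   Context: $\mathbb{T}=\mathbb{R}/\mathbb{Z}$, $\mathbb{A}=\mathbb{T}\times\mathbb{R}$ with coordinates $(\theta,r)$ and symplectic form $\omega=-d(r\,d\theta)$. A symplectic twist diffeomorphism is a $C^1$ diffeomorphism $f:\mathbb{A}\to\mathbb{A}$ isotopic to the identity, with $f^*\omega=\omega$, and with the twist property: for any lift $F=(F_1,F_2):\mathbb{R}^2\to\mathbb{R}^2$ of $f$ and any $\tilde\theta\in\mathbb{R}$, the map $r\mapsto F_1(\tilde\theta,r)$ is an increasing $C^1$ diffeomorphism from $\mathbb{R}$ onto $\mathbb{R}$. A continuous ($C^0$) foliation of $\mathbb{A}$ into graphs is a partition of $\mathbb{A}$ into graphs of continuous functions $\eta_c:\mathbb{T}\to\mathbb{R}$, $c\in\mathbb{R}$, normalized by $\int_{\mathbb{T}}\eta_c=c$, such that $(\theta,c)\mapsto(\theta,\eta_c(\theta))$ is a homeomorphism of $\mathbb{A}$. A foliation is invariant under $f$ if every leaf is mapped onto itself by $f$. $f$ is $C^0$-integrable if it has an invariant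 $C^0$-foliation into graphs. The generating function of such a foliation is the unique continuous $u:\mathbb{A}\to\mathbb{R}$ that is $C^1$ in the $\mathbb{T}$ variable with $u(0,c)=0$ for all $c$ and such that, for all $c$, the graph of $c+\frac{\partial u}{\partial\theta}(\cdot,c)$ is a leaf. *)

theory Defs
  imports "HOL-Analysis.Analysis"
begin

section \<open>The annulus\<close>

definition circle_rel :: "real \<Rightarrow> real \<Rightarrow> bool"
  where "circle_rel x y \<longleftrightarrow> x - y \<in> \<int>"

lemma equivp_circle_rel: "equivp circle_rel"
proof (rule equivpI)
  show "reflp circle_rel"
    by (auto simp: reflp_def circle_rel_def)
  show "symp circle_rel"
    by (metis (no_types, lifting) Ints_minus circle_rel_def minus_diff_eq sympI)
  show "transp circle_rel"
  proof (rule transpI)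
    fix x y z assume "circle_rel x y" "circle_rel y z"
    then have "(x - y) + (y - z) \<in> \<int>"
      unfolding circle_rel_def by (rule Ints_add)
    then show "circle_rel x z"
      by (simp add: circle_rel_def)
  qed
qed

quotient_type circle = real / circle_rel
  morphisms rep_circle to_circle
  by (rule equivp_circle_rel)

text \<open>The topology of \<open>\<real>/\<int>\<close> is the quotient topology.\<close>

instantiation circle :: topological_space
begin

definition open_circle :: "circle set \<Rightarrow> bool"
  where "open_circle U \<longleftrightarrow> open (to_circle -` U)"

instance
proof
  show "open (UNIV :: circle set)"
    by (simp add: open_circle_def)
  show "open (S \<inter> T)" if "open S" "open T" for S T :: "circle set"
    using that by (simp add: open_circle_def vimage_Int open_Int)
  show "open (\<Union>K)" if "\<forall>S\<in>K. open S" for K :: "circle set set"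
    using that by (simp add: open_circle_def vimage_Union open_UN)
qed

end

type_synonym annulus = "circle \<times> real"

definition to_annulus :: "real \<times> real \<Rightarrow> annulus"
  where "to_annulus p = (to_circle (fst p), snd p)"

lift_definition circle_sin :: "circle \<Rightarrow> real" is "\<lambda>t. sin (2 * pi * t)"
proof -
  fix x y :: real
  assume "circle_rel x y"
  then obtain k :: int where "x = y + of_int k"
    unfolding circle_rel_def by (metis Ints_cases add.commute diff_add_cancel)
  then have "2 * pi * x = 2 * pi * y + 2 * pi * of_int k"
    by (simp add: algebra_simps)
  then show "sin (2 * pi * x) = sin (2 * pi * y)"
    by (simp only: sin_add sin_int_2pin cos_int_2pin)
qed

lift_definition circle_cos :: "circle \<Rightarrow> real" is "\<lambda>t. cos (2 * pi * t)"
proof -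
  fix x y :: real
  assume "circle_rel x y"
  then obtain k :: int where "x = y + of_int k"
    unfolding circle_rel_def by (metis Ints_cases add.commute diff_add_cancel)
  then have "2 * pi * x = 2 * pi * y + 2 * pi * of_int k"
    by (simp add: algebra_simps)
  then show "cos (2 * pi * x) = cos (2 * pi * y)"
    by (simp only: cos_add sin_int_2pin cos_int_2pin)
qed

definition circle_integral :: "(circle \<Rightarrow> real) \<Rightarrow> real"
  where "circle_integral g = integral {0..1} (\<lambda>t. g (to_circle t))"

text \<open>Differentiation along the circle is differentiation of the 1-periodic function
  \<open>t \<mapsto> g (to_circle t)\<close>; the value does not depend on the chosen representative.\<close>

definition circle_C1 :: "(circle \<Rightarrow> real) \<Rightarrow> bool"
  where "circle_C1 g \<longleftrightarrow> (\<lambda>t. g (to_circle t)) C1_differentiable_on UNIV"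

definition circle_deriv :: "(circle \<Rightarrow> real) \<Rightarrow> circle \<Rightarrow> real"
  where "circle_deriv g \<theta> = deriv (\<lambda>t. g (to_circle t)) (rep_circle \<theta>)"

definition circle_smooth :: "(circle \<Rightarrow> real) \<Rightarrow> bool"
  where "circle_smooth g \<longleftrightarrow>
    (\<forall>n t. (deriv ^^ n) (\<lambda>s. g (to_circle s)) differentiable (at t))"


section \<open>Symplectic twist diffeomorphisms\<close>

definition C1_map :: "('a::real_normed_vector \<Rightarrow> 'b::real_normed_vector) \<Rightarrow> bool"
  where "C1_map F \<longleftrightarrow>
    (\<exists>F' :: 'a \<Rightarrow> 'a \<Rightarrow>\<^sub>L 'b. (\<forall>x. (F has_derivative blinfun_apply (F' x)) (at x)) \<and>
      continuous_on UNIV F')"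

definition is_lift :: "(real \<times> real \<Rightarrow> real \<times> real) \<Rightarrow> (annulus \<Rightarrow> annulus) \<Rightarrow> bool"
  where "is_lift F f \<longleftrightarrow>
    continuous_on UNIV F \<and> (\<forall>p. to_annulus (F p) = f (to_annulus p))"

text \<open>The differentiable structure of the annulus is the one that makes the universal covering
  \<^term>\<open>to_annulus\<close> a local diffeomorphism. Every continuous self-map of the annulus has a lift
  to the plane, unique up to an integer translation of the first coordinate, so such a map is
  \<open>C\<^sup>1\<close> iff it has a \<open>C\<^sup>1\<close> lift.\<close>

definition annulus_C1 :: "(annulus \<Rightarrow> annulus) \<Rightarrow> bool"
  where "annulus_C1 f \<longleftrightarrow> (\<exists>F. is_lift F f \<and> C1_map F)"

definition annulus_C1_diffeo :: "(annulus \<Rightarrow> annulus) \<Rightarrow> bool"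
  where "annulus_C1_diffeo f \<longleftrightarrow> bij f \<and> annulus_C1 f \<and> annulus_C1 (inv f)"

text \<open>The isotopy is only required to be a jointly continuous path of homeomorphisms, the weakest
  of the usual meanings of the word.\<close>

definition isotopic_to_id :: "(annulus \<Rightarrow> annulus) \<Rightarrow> bool"
  where "isotopic_to_id f \<longleftrightarrow>
    homotopic_with (homeomorphic_map euclidean euclidean) euclidean euclidean id f"

text \<open>\<open>\<omega> = - d(r d\<theta>) = - dr \<and> d\<theta> = d\<theta> \<and> dr\<close>, which has constant coefficients in the
  coordinates \<open>(\<theta>, r)\<close>.\<close>

definition omega :: "real \<times> real \<Rightarrow> real \<times> real \<Rightarrow> real"
  where "omega v w = fst v * snd w - snd v * fst w"

definition preserves_omega :: "(annulus \<Rightarrow> annulus) \<Rightarrow> bool"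
  where "preserves_omega f \<longleftrightarrow>
    (\<forall>F. is_lift F f \<longrightarrow>
      (\<forall>p F'. (F has_derivative F') (at p) \<longrightarrow> (\<forall>v w. omega (F' v) (F' w) = omega v w)))"

definition increasing_C1_diffeo :: "(real \<Rightarrow> real) \<Rightarrow> bool"
  where "increasing_C1_diffeo g \<longleftrightarrow>
    strict_mono g \<and> bij g \<and> g C1_differentiable_on UNIV \<and> inv g C1_differentiable_on UNIV"

definition twist_property :: "(annulus \<Rightarrow> annulus) \<Rightarrow> bool"
  where "twist_property f \<longleftrightarrow>
    (\<forall>F. is_lift F f \<longrightarrow> (\<forall>\<theta>. increasing_C1_diffeo (\<lambda>r. fst (F (\<theta>, r)))))"

definition symplectic_twist_diffeo :: "(annulus \<Rightarrow> annulus) \<Rightarrow> bool"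
  where "symplectic_twist_diffeo f \<longleftrightarrow>
    annulus_C1_diffeo f \<and> isotopic_to_id f \<and> preserves_omega f \<and> twist_property f"


section \<open>Foliations into graphs\<close>

definition circle_graph :: "(circle \<Rightarrow> real) \<Rightarrow> annulus set"
  where "circle_graph \<eta> = {(\<theta>, \<eta> \<theta>) | \<theta>. True}"

definition C0_foliation :: "annulus set set \<Rightarrow> bool"
  where "C0_foliation \<F> \<longleftrightarrow>
    partition_on UNIV \<F> \<and>
    (\<exists>\<eta> :: real \<Rightarrow> circle \<Rightarrow> real.
      \<F> = range (\<lambda>c. circle_graph (\<eta> c)) \<and>
      (\<forall>c. continuous_on UNIV (\<eta> c) \<and> circle_integral (\<eta> c) = c) \<and>
      homeomorphic_map euclidean euclidean (\<lambda>(\<theta>, c). (\<theta>, \<eta> c \<theta>)))"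

definition invariant_foliation :: "(annulus \<Rightarrow> annulus) \<Rightarrow> annulus set set \<Rightarrow> bool"
  where "invariant_foliation f \<F> \<longleftrightarrow> (\<forall>L\<in>\<F>. f ` L = L)"

definition C0_integrable :: "(annulus \<Rightarrow> annulus) \<Rightarrow> bool"
  where "C0_integrable f \<longleftrightarrow> (\<exists>\<F>. C0_foliation \<F> \<and> invariant_foliation f \<F>)"

definition generates_foliation :: "(annulus \<Rightarrow> real) \<Rightarrow> annulus set set \<Rightarrow> bool"
  where "generates_foliation u \<F> \<longleftrightarrow>
    continuous_on UNIV u \<and>
    (\<forall>c. circle_C1 (\<lambda>\<theta>. u (\<theta>, c))) \<and>
    (\<forall>c. u (to_circle 0, c) = 0) \<and>
    (\<forall>c. circle_graph (\<lambda>\<theta>. c + circle_deriv (\<lambda>\<phi>. u (\<phi>, c)) \<theta>) \<in> \<F>)"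

definition is_generating_function :: "(annulus \<Rightarrow> real) \<Rightarrow> annulus set set \<Rightarrow> bool"
  where "is_generating_function u \<F> \<longleftrightarrow>
    generates_foliation u \<F> \<and> (\<forall>v. generates_foliation v \<F> \<longrightarrow> v = u)"

end

theory Submission imports Defs begin

text \<open>
  The positive half is elementary: for a fixed angle, \<open>c \<mapsto> c + \<epsilon> c * cos (2 \<pi> \<theta>)\<close> is the
  identity plus a contraction, so the leaves fill the annulus exactly once and the leaf through a
  point depends continuously on it. A generating function of the foliation has, on each circle, a
  derivative of the form \<open>c' - c + \<epsilon> c' * cos (2 \<pi> \<theta>)\<close>; periodicity forces \<open>c' = c\<close>, whence
  uniqueness.

  For the negative half, let a symplectic twist diffeomorphism \<open>f\<close> preserve every leaf, let
  \<open>F\<close> be a lift and let \<open>g c\<close> be the map that \<open>F\<close> induces on the angles of the leaf \<open>c\<close>. The claim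
  is that \<open>\<epsilon>\<close> is then \<open>C\<^sup>1\<close>.

  Area preservation is used through a generating function \<open>S\<close> of \<open>F\<close>
  (lemma \<open>generating_function\<close>), for which \<open>S (x, g c x)\<close> is, up to a constant \<open>A c\<close>, the variation
  from \<open>x\<close> to \<open>g c x\<close> of a primitive of the leaf \<open>c\<close>. Subtracting these identities for two leaves
  \<open>s\<close>, \<open>t\<close> and dividing by \<open>t - s\<close> gives, in the limit, that \<open>f\<close> preserves the infinitesimal area
  between neighbouring leaves: if a difference quotient of \<open>\<epsilon>\<close> tends to \<open>e\<close> while both leaves tend
  to \<open>c\<close>, then \<open>g c\<close> preserves the measure \<open>(1 + e cos (2 \<pi> x)) dx\<close>
  (lemma \<open>limit_density_invariant\<close>).

  If two different limits \<open>e\<close> existed at the same leaf, then \<open>g c\<close> would preserve both \<open>dx\<close> and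
  \<open>cos (2 \<pi> x) dx\<close>, hence be a translation by an integer, so that \<open>f\<close> fixes the leaf pointwise. By
  the twist condition such leaves are isolated, and away from them \<open>\<epsilon>\<close> is strictly
  differentiable, hence \<open>C\<^sup>1\<close>.

  At a leaf \<open>s\<close> of fixed points, invariance of the measures of the neighbouring leaves says to first
  order that the flux \<open>(1 + e cos) * (1 + q cos) * b\<close> does not depend on the angle, where \<open>e\<close> is the
  derivative of \<open>\<epsilon>\<close> at a nearby leaf, \<open>q\<close> the difference quotient to \<open>s\<close> and \<open>b\<close> the twist
  along the leaf \<open>s\<close>. Comparing three angles shows that \<open>q + e\<close> converges
  (lemma \<open>translation_leaf_derivative\<close>). As \<open>q + e\<close> is the derivative of
  \<open>(t - s) * (\<epsilon> t - \<epsilon> s)\<close> divided by \<open>t - s\<close>, l'Hopital's rule gives the convergence of \<open>q\<close>, hence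
  that of \<open>e\<close>, to half the limit of the sum. So \<open>\<epsilon>\<close> is \<open>C\<^sup>1\<close> there as well.
\<close>

section \<open>Exactness of closed one-forms on the plane\<close>

text \<open>The Poincare lemma for \<open>P dx + Q dy\<close>: integrate the form along the segment from the origin.
  Closedness, that is \<open>\<partial>P/\<partial>y = \<partial>Q/\<partial>x = Py\<close>, turns the derivative under the integral sign into the
  radial derivative of \<open>t * P (t x, t y)\<close>, respectively \<open>t * Q (t x, t y)\<close>.\<close>

lemma closed_form_on_plane_exact:
  fixes P Q Px Py Qy :: "real \<times> real \<Rightarrow> real"
  assumes P: "\<And>p. (P has_derivative (\<lambda>v. Px p * fst v + Py p * snd v)) (at p)"
    and Q: "\<And>p. (Q has_derivative (\<lambda>v. Py p * fst v + Qy p * snd v)) (at p)"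
    and cont: "continuous_on UNIV Px" "continuous_on UNIV Py" "continuous_on UNIV Qy"
  obtains S where "\<And>p. (S has_derivative (\<lambda>v. P p * fst v + Q p * snd v)) (at p)"
proof -
  define S where
    "S = (\<lambda>x y. integral (cbox 0 1) (\<lambda>t. P (t * x, t * y) * x + Q (t * x, t * y) * y))"
  have contP: "continuous_on UNIV P" and contQ: "continuous_on UNIV Q"
    using P Q by (meson differentiable_def differentiable_imp_continuous_on
        differentiable_at_imp_differentiable_on)+
  note cts = continuous_on_compose2[OF cont(1)] continuous_on_compose2[OF cont(2)]
    continuous_on_compose2[OF cont(3)] continuous_on_compose2[OF contP]
    continuous_on_compose2[OF contQ]
  have radial: "((\<lambda>t. P (t * x, t * y)) has_field_derivative
       Px (t * x, t * y) * x + Py (t * x, t * y) * y) (at t)"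
     "((\<lambda>t. Q (t * x, t * y)) has_field_derivative
       Py (t * x, t * y) * x + Qy (t * x, t * y) * y) (at t)" for x y t
    unfolding has_field_derivative_def
    by (rule has_derivative_eq_rhs, rule has_derivative_compose[OF _ P]
        has_derivative_compose[OF _ Q], auto intro!: derivative_eq_intros simp: algebra_simps)+
  have in_x: "((\<lambda>x. P (t * x, t * y)) has_field_derivative Px (t * x, t * y) * t) (at x)"
     "((\<lambda>x. Q (t * x, t * y)) has_field_derivative Py (t * x, t * y) * t) (at x)" for x y t
    unfolding has_field_derivative_def
    by (rule has_derivative_eq_rhs, rule has_derivative_compose[OF _ P]
        has_derivative_compose[OF _ Q], auto intro!: derivative_eq_intros simp: algebra_simps)+
  have in_y: "((\<lambda>y. P (t * x, t * y)) has_field_derivative Py (t * x, t * y) * t) (at y)"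
     "((\<lambda>y. Q (t * x, t * y)) has_field_derivative Qy (t * x, t * y) * t) (at y)" for x y t
    unfolding has_field_derivative_def
    by (rule has_derivative_eq_rhs, rule has_derivative_compose[OF _ P]
        has_derivative_compose[OF _ Q], auto intro!: derivative_eq_intros simp: algebra_simps)+
  have Sx: "((\<lambda>x. S x y) has_field_derivative P (x, y)) (at x)" for x y
  proof -
    let ?D = "\<lambda>x t. P (t * x, t * y)
      + t * (Px (t * x, t * y) * x + Py (t * x, t * y) * y)"
    have "((\<lambda>x. S x y) has_field_derivative integral (cbox 0 1) (?D x)) (at x within UNIV)"
      unfolding S_def
    proof (rule leibniz_rule_field_derivative)
      show "((\<lambda>x. P (t * x, t * y) * x + Q (t * x, t * y) * y) has_field_derivative ?D x t)
          (at x within UNIV)" for x t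
        by (rule derivative_eq_intros in_x refl)+ (simp add: algebra_simps)
      show "(\<lambda>t. P (t * x, t * y) * x + Q (t * x, t * y) * y) integrable_on cbox 0 1" for x
        by (intro integrable_continuous continuous_intros cts) auto
      show "continuous_on (UNIV \<times> cbox 0 1) (\<lambda>(x, t). ?D x t)"
        unfolding split_beta by (intro continuous_intros cts) auto
    qed auto
    moreover have "(?D x has_integral 1 * P (1 * x, 1 * y) - 0 * P (0 * x, 0 * y)) {0..1}"
      by (rule fundamental_theorem_of_calculus)
        (auto simp flip: has_real_derivative_iff_has_vector_derivative
          intro!: derivative_eq_intros radial DERIV_subset[OF radial(1)])
    ultimately show ?thesis
      by (simp add: integral_unique cbox_interval)
  qed
  have Sy: "((\<lambda>y. S x y) has_field_derivative Q (x, y)) (at y)" for x y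
  proof -
    let ?D = "\<lambda>y t. Q (t * x, t * y)
      + t * (Py (t * x, t * y) * x + Qy (t * x, t * y) * y)"
    have "((\<lambda>y. S x y) has_field_derivative integral (cbox 0 1) (?D y)) (at y within UNIV)"
      unfolding S_def
    proof (rule leibniz_rule_field_derivative)
      show "((\<lambda>y. P (t * x, t * y) * x + Q (t * x, t * y) * y) has_field_derivative ?D y t)
          (at y within UNIV)" for y t
        by (rule derivative_eq_intros in_y refl)+ (simp add: algebra_simps)
      show "(\<lambda>t. P (t * x, t * y) * x + Q (t * x, t * y) * y) integrable_on cbox 0 1" for y
        by (intro integrable_continuous continuous_intros cts) auto
      show "continuous_on (UNIV \<times> cbox 0 1) (\<lambda>(y, t). ?D y t)"
        unfolding split_beta by (intro continuous_intros cts) auto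
    qed auto
    moreover have "(?D y has_integral 1 * Q (1 * x, 1 * y) - 0 * Q (0 * x, 0 * y)) {0..1}"
      by (rule fundamental_theorem_of_calculus)
        (auto simp flip: has_real_derivative_iff_has_vector_derivative
          intro!: derivative_eq_intros radial DERIV_subset[OF radial(2)])
    ultimately show ?thesis
      by (simp add: integral_unique cbox_interval)
  qed
  have "((\<lambda>(x, y). S x y) has_derivative
      (\<lambda>(tx, ty). P (x, y) * tx + blinfun_apply (blinfun_mult_right (Q (x, y))) ty))
      (at (x, y) within UNIV \<times> UNIV)" for x y
  proof (rule has_derivative_partialsI)
    show "((\<lambda>x. S x y) has_derivative (\<lambda>tx. P (x, y) * tx)) (at x within UNIV)"
      using Sx by (simp add: has_field_derivative_def)
    show "((\<lambda>y. S x y) has_derivative blinfun_apply (blinfun_mult_right (Q (x, y))))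
        (at y within UNIV)" for x y
      using Sy[of x y] by (simp add: has_field_derivative_def mult.commute)
    have "continuous_on UNIV (\<lambda>(x, y). blinfun_mult_right (Q (x, y)))"
      using contQ by (auto simp: split_beta intro!: continuous_intros)
    then show "continuous (at (x, y) within UNIV \<times> UNIV) (\<lambda>(x, y). blinfun_mult_right (Q (x, y)))"
      by (simp add: continuous_on_eq_continuous_at split_beta')
  qed auto
  then have "((\<lambda>(x, y). S x y) has_derivative (\<lambda>v. P p * fst v + Q p * snd v)) (at p)" for p
    by (cases p) (simp add: split_beta' mult.commute)
  then show ?thesis
    by (rule that)
qed

section \<open>Area-preserving twist maps of the plane\<close>

text \<open>The pair \<open>(f1, f2)\<close> is a map of the plane, to be thought of as the lift of an annulus map, and
  \<open>a\<close>, \<open>b\<close>, \<open>c\<close>, \<open>d\<close> are the entries of its Jacobian matrix, row by row. In particular \<open>b\<close>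
  measures the twist.\<close>

locale area_preserving_twist =
  fixes f1 f2 a b c d :: "real \<times> real \<Rightarrow> real"
  assumes f1: "\<And>p. (f1 has_derivative (\<lambda>v. a p * fst v + b p * snd v)) (at p)"
    and f2: "\<And>p. (f2 has_derivative (\<lambda>v. c p * fst v + d p * snd v)) (at p)"
    and cont: "continuous_on UNIV a" "continuous_on UNIV b"
      "continuous_on UNIV c" "continuous_on UNIV d"
    and area: "\<And>p. a p * d p - b p * c p = 1"
    and twist_bij: "\<And>x. bij (\<lambda>r. f1 (x, r))"
    and twist_mono: "\<And>x. strict_mono (\<lambda>r. f1 (x, r))"
    and twist_nz: "\<And>p. b p \<noteq> 0"
begin

lemma cont_f1: "continuous_on UNIV f1" and cont_f2: "continuous_on UNIV f2"
  using f1 f2 by (meson differentiable_def differentiable_imp_continuous_on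
        differentiable_at_imp_differentiable_on)+

text \<open>By the twist condition \<open>(x, X) = (x, f1 (x, r))\<close> are \<open>C\<^sup>1\<close> coordinates on the plane. In them the
  functions \<open>r\<close> and \<open>R = f2 (x, r)\<close> are \<open>C\<^sup>1\<close>, and \<open>R dX - r dx\<close> is closed because both mixed
  derivatives equal \<open>- 1 / b\<close>, the one of \<open>R\<close> since the Jacobian determinant is \<open>1\<close>. Passing to
  these coordinates is what makes a map of class \<open>C\<^sup>1\<close> regular enough: the pullback of
  \<open>r dx\<close> by the map itself is only continuous.\<close>

lemma generating_function:
  obtains S :: "real \<times> real \<Rightarrow> real"
  where "\<And>x r. (S has_derivative (\<lambda>v. f2 (x, r) * snd v - r * fst v)) (at (x, f1 (x, r)))"
proof -
  define \<Psi> where "\<Psi> = (\<lambda>p. (fst p, f1 p))"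
  define \<rho> where "\<rho> = (\<lambda>q. (fst q, inv (\<lambda>r. f1 (fst q, r)) (snd q)))"
  have \<rho>\<Psi>: "\<rho> (\<Psi> p) = p" for p
    using inv_f_f[OF bij_is_inj[OF twist_bij], of "fst p" "snd p"]
    by (cases p) (simp add: \<rho>_def \<Psi>_def)
  have \<Psi>\<rho>: "\<Psi> (\<rho> q) = q" for q
    using surj_f_inv_f[OF bij_is_surj[OF twist_bij], of "fst q" "snd q"]
    by (cases q) (simp add: \<rho>_def \<Psi>_def)
  have cont\<Psi>: "continuous_on UNIV \<Psi>"
    unfolding \<Psi>_def by (intro continuous_intros cont_f1)
  have d\<Psi>: "(\<Psi> has_derivative (\<lambda>v. (fst v, a p * fst v + b p * snd v))) (at p)" for p
    unfolding \<Psi>_def by (auto intro!: derivative_eq_intros f1)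
  \<comment> \<open>The coordinate change \<open>\<Psi>\<close> is a bijection of the plane with inverse \<open>\<rho>\<close>; the strong inverse
    function theorem provides the differentiability, and with it the continuity, of \<open>\<rho>\<close>.\<close>
  have "(\<rho> has_derivative (\<lambda>v. (fst v, (snd v - a p * fst v) / b p))) (at (\<Psi> p))" for p
    by (rule has_derivative_inverse_strong[OF open_UNIV _ cont\<Psi> _ d\<Psi>])
      (auto simp: \<rho>\<Psi> fun_eq_iff twist_nz)
  from this[of "\<rho> _", unfolded \<Psi>\<rho>]
  have d\<rho>: "(\<rho> has_derivative (\<lambda>v. (fst v, (snd v - a (\<rho> q) * fst v) / b (\<rho> q)))) (at q)" for q .
  then have cont\<rho>: "continuous_on UNIV \<rho>"
    by (meson differentiable_def differentiable_imp_continuous_on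
        differentiable_at_imp_differentiable_on)
  let ?P = "\<lambda>q. - snd (\<rho> q)" and ?Q = "\<lambda>q. f2 (\<rho> q)"
  have dP: "(?P has_derivative (\<lambda>v. (a (\<rho> q) / b (\<rho> q)) * fst v + (- 1 / b (\<rho> q)) * snd v)) (at q)" for q
    using has_derivative_minus[OF has_derivative_snd[OF d\<rho>[of q]]]
    by (rule has_derivative_eq_rhs) (auto simp: fun_eq_iff field_simps twist_nz)
  have dQ: "(?Q has_derivative (\<lambda>v. (- 1 / b (\<rho> q)) * fst v + (d (\<rho> q) / b (\<rho> q)) * snd v)) (at q)" for q
  proof (rule has_derivative_eq_rhs[OF has_derivative_compose[OF d\<rho> f2]])
    have "c (\<rho> q) * x + d (\<rho> q) * ((y - a (\<rho> q) * x) / b (\<rho> q))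
        = - (a (\<rho> q) * d (\<rho> q) - b (\<rho> q) * c (\<rho> q)) / b (\<rho> q) * x + d (\<rho> q) / b (\<rho> q) * y" for x y
      by (simp add: field_simps twist_nz)
    then show "(\<lambda>v. c (\<rho> q) * fst (fst v, (snd v - a (\<rho> q) * fst v) / b (\<rho> q)) +
           d (\<rho> q) * snd (fst v, (snd v - a (\<rho> q) * fst v) / b (\<rho> q))) =
        (\<lambda>v. - 1 / b (\<rho> q) * fst v + d (\<rho> q) / b (\<rho> q) * snd v)"
      by (simp add: area fun_eq_iff)
  qed
  have ct: "continuous_on UNIV (\<lambda>q. g (\<rho> q))" if "continuous_on UNIV g" for g :: "real \<times> real \<Rightarrow> real"
    by (rule continuous_on_compose2[OF that cont\<rho>]) auto
  have "continuous_on UNIV (\<lambda>q. a (\<rho> q) / b (\<rho> q))"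
    "continuous_on UNIV (\<lambda>q. - 1 / b (\<rho> q))"
    "continuous_on UNIV (\<lambda>q. d (\<rho> q) / b (\<rho> q))"
    by (intro continuous_intros ct cont; simp add: twist_nz)+
  from closed_form_on_plane_exact[OF dP dQ this]
  obtain S where S: "\<And>q. (S has_derivative (\<lambda>v. ?P q * fst v + ?Q q * snd v)) (at q)"
    by blast
  show ?thesis
  proof
    show "(S has_derivative (\<lambda>v. f2 (x, r) * snd v - r * fst v)) (at (x, f1 (x, r)))" for x r
      using S[of "\<Psi> (x, r)"] by (simp add: \<rho>\<Psi>) (simp add: \<Psi>_def algebra_simps)
  qed
qed

end

section \<open>Measures invariant on a leaf\<close>
lemma mvt_between:
  fixes g g' :: "real \<Rightarrow> real"
  assumes "\<And>r. (g has_real_derivative g' r) (at r)"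
  obtains z where "\<bar>z - u\<bar> \<le> \<bar>v - u\<bar>" "g v - g u = g' z * (v - u)"
proof (cases u v rule: linorder_cases)
  case less
  then show ?thesis
    using MVT2[of u v g g'] assms that by (force simp: mult.commute)
next
  case equal
  then show ?thesis using that[of u] by simp
next
  case greater
  then obtain z where "v < z" "z < u" "g u - g v = (u - v) * g' z"
    using MVT2[of v u g g'] assms by blast
  then show ?thesis using that[of z] by (simp add: algebra_simps)
qed

text \<open>The distribution function of the density \<open>1 + e * cos (2 * pi * x)\<close>. A differentiable
  map \<open>g\<close> preserves the form \<open>(1 + e * cos (2 * pi * x)) dx\<close> if and only if
  \<open>circle_primitive e (g x) - circle_primitive e x\<close> is constant, and invariance will always be
  expressed in this way.\<close>

definition circle_primitive :: "real \<Rightarrow> real \<Rightarrow> real" where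
  "circle_primitive e x = x + e / (2 * pi) * sin (2 * pi * x)"

lemma circle_primitive_tendsto:
  fixes F :: "'a::t2_space filter"
  assumes "(e \<longlongrightarrow> e0) F" "(y \<longlongrightarrow> y0) F"
  shows "((\<lambda>n. circle_primitive (e n) (y n)) \<longlongrightarrow> circle_primitive e0 y0) F"
  unfolding circle_primitive_def
  by (intro tendsto_add tendsto_mult tendsto_divide tendsto_sin tendsto_const assms) simp

text \<open>Two different densities of this form span \<open>dx\<close> and \<open>cos (2 * pi * x) dx\<close>. Invariance of the
  former makes \<open>g\<close> a translation by some \<open>m\<close>, and invariance of the latter makes \<open>m\<close> an integer: the
  constant \<open>\<kappa>\<close> by which \<open>sin (2 * pi * x)\<close> grows vanishes, as \<open>x = 0\<close> and \<open>x = 1/2\<close> show, and then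
  \<open>x = 1/4\<close> gives \<open>cos (2 * pi * m) = 1\<close>.\<close>

lemma two_invariant_densities_imp_integer_translation:
  fixes g :: "real \<Rightarrow> real"
  assumes k1: "\<And>x. circle_primitive e1 (g x) - circle_primitive e1 x = k1"
    and k2: "\<And>x. circle_primitive e2 (g x) - circle_primitive e2 x = k2"
    and ne: "e1 \<noteq> e2"
  obtains m :: int where "\<And>x. g x = x + of_int m"
proof -
  define \<Delta> where "\<Delta> = (\<lambda>x. sin (2 * pi * g x) - sin (2 * pi * x))"
  have d1: "g x - x + e1 / (2 * pi) * \<Delta> x = k1" for x
    using k1[of x] unfolding circle_primitive_def \<Delta>_def right_diff_distrib by linarith
  have d2: "g x - x + e2 / (2 * pi) * \<Delta> x = k2" for x
    using k2[of x] unfolding circle_primitive_def \<Delta>_def right_diff_distrib by linarith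
  define \<kappa> where "\<kappa> = (k1 - k2) / ((e1 - e2) / (2 * pi))"
  have \<Delta>: "\<Delta> x = \<kappa>" for x
  proof -
    have "(e1 - e2) / (2 * pi) * \<Delta> x = k1 - k2"
      using d1[of x] d2[of x] unfolding diff_divide_distrib left_diff_distrib by linarith
    moreover have "(e1 - e2) / (2 * pi) \<noteq> 0"
      using ne by simp
    ultimately show ?thesis unfolding \<kappa>_def by (metis nonzero_mult_div_cancel_left)
  qed
  then have sin_diff: "sin (2 * pi * g x) - sin (2 * pi * x) = \<kappa>" for x
    unfolding \<Delta>_def .
  define m where "m = k1 - e1 / (2 * pi) * \<kappa>"
  have g: "g x = x + m" for x
    using d1[of x] unfolding \<Delta> m_def by linarith
  have "sin (2 * pi * m) = \<kappa>"
    using sin_diff[of 0] g[of 0] by simp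
  moreover have "- sin (2 * pi * m) = \<kappa>"
    using sin_diff[of "1/2"] g[of "1/2"] by (simp add: algebra_simps sin_add)
  moreover have "cos (2 * pi * m) - 1 = \<kappa>"
    using sin_diff[of "1/4"] g[of "1/4"] by (simp add: algebra_simps sin_add)
  ultimately have "cos (2 * pi * m) = 1"
    by simp
  then obtain n :: int where "2 * pi * m = n * 2 * pi"
    by (auto simp: cos_one_2pi_int)
  then have "m = n"
    by simp
  then show ?thesis using g that by blast
qed

text \<open>Invariance of the leaves is stated on the cover: the image of a point over the angle \<open>x\<close> on the
  leaf \<open>s\<close> lies on the same leaf. The Lipschitz bound \<open>L < 1\<close> makes the leaves disjoint.\<close>

locale invariant_cosine_leaves = area_preserving_twist +
  fixes \<epsilon> :: "real \<Rightarrow> real" and L :: real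
  assumes lip: "\<And>s t. \<bar>\<epsilon> s - \<epsilon> t\<bar> \<le> L * \<bar>s - t\<bar>" and L1: "L < 1"
    and invariant: "\<And>s x. let r = s + \<epsilon> s * cos (2 * pi * x) in
       f2 (x, r) = s + \<epsilon> s * cos (2 * pi * f1 (x, r))"
begin

definition leaf :: "real \<Rightarrow> real \<Rightarrow> real" where
  "leaf s x = s + \<epsilon> s * cos (2 * pi * x)"

definition leaf_map :: "real \<Rightarrow> real \<Rightarrow> real" where
  "leaf_map s x = f1 (x, leaf s x)"

definition quot :: "real \<Rightarrow> real \<Rightarrow> real" where
  "quot s t = (\<epsilon> t - \<epsilon> s) / (t - s)"

lemma leaf_invariant: "f2 (x, leaf s x) = leaf s (leaf_map s x)"
  using invariant[where s = s and x = x] by (simp add: Let_def leaf_def leaf_map_def)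

lemma quot_bound: "\<bar>quot s t\<bar> \<le> L" if "s \<noteq> t"
  using lip[of t s] that by (simp add: quot_def field_simps)

lemma leaf_diff: "leaf t x - leaf s x = (t - s) * (1 + quot s t * cos (2 * pi * x))" if "s \<noteq> t"
  using that by (simp add: leaf_def quot_def field_simps)

lemma quot_cos_less_1: "\<bar>quot s t * cos (2 * pi * x)\<bar> < 1" if "s \<noteq> t"
proof -
  have "\<bar>quot s t\<bar> * \<bar>cos (2 * pi * x)\<bar> \<le> L * 1"
    using quot_bound[OF that] by (intro mult_mono) auto
  then show ?thesis using L1 by (simp add: abs_mult)
qed

lemma leaf_strict_mono: "leaf s x < leaf t x" if "s < t"
proof -
  have "0 < (t - s) * (1 + quot s t * cos (2 * pi * x))"
    using quot_cos_less_1[of s t x] that by (intro mult_pos_pos) auto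
  then show ?thesis using leaf_diff[of s t x] that by simp
qed

lemma cont_eps: "isCont \<epsilon> s"
proof -
  have "((\<lambda>t. L * \<bar>t - s\<bar>) \<longlongrightarrow> L * \<bar>s - s\<bar>) (at s)"
    by (intro tendsto_intros)
  then have bound: "((\<lambda>t. L * \<bar>t - s\<bar>) \<longlongrightarrow> 0) (at s)"
    by simp
  have "((\<lambda>t. \<epsilon> t - \<epsilon> s) \<longlongrightarrow> 0) (at s)"
    by (rule Lim_null_comparison[OF _ bound]) (simp add: lip)
  then show ?thesis
    by (simp add: isCont_def LIM_zero_cancel)
qed

lemma leaf_tendsto:
  fixes F :: "'a::t2_space filter"
  assumes "(X \<longlongrightarrow> s) F" "(Y \<longlongrightarrow> x) F"
  shows "((\<lambda>n. leaf (X n) (Y n)) \<longlongrightarrow> leaf s x) F"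
  unfolding leaf_def by (intro tendsto_intros isCont_tendsto_compose[OF cont_eps] assms)

lemma tendsto_on_plane:
  assumes "continuous_on UNIV (g :: real \<times> real \<Rightarrow> real)" "(X \<longlongrightarrow> x) F" "(Y \<longlongrightarrow> y) F"
  shows "((\<lambda>n. g (X n, Y n)) \<longlongrightarrow> g (x, y)) F"
  by (rule isCont_tendsto_compose[where g = g])
    (use assms in \<open>auto simp: continuous_on_eq_continuous_at intro: tendsto_Pair\<close>)

lemma leaf_map_tendsto:
  fixes F :: "'a::t2_space filter"
  assumes "(X \<longlongrightarrow> s) F"
  shows "((\<lambda>n. leaf_map (X n) x) \<longlongrightarrow> leaf_map s x) F"
  unfolding leaf_map_def
  by (intro tendsto_on_plane[OF cont_f1] leaf_tendsto tendsto_const assms)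

lemma leaf_map_strict_mono: "leaf_map s x < leaf_map t x" if "s < t"
  using strict_monoD[OF twist_mono leaf_strict_mono[OF that]] by (simp add: leaf_map_def)

lemma vertical_derivative:
  "((\<lambda>r. f1 (x, r)) has_real_derivative b (x, r)) (at r)"
  unfolding has_field_derivative_def
  by (rule has_derivative_eq_rhs, rule has_derivative_compose[OF _ f1])
    (auto intro!: derivative_eq_intros simp: algebra_simps)

text \<open>The difference of the primitives of two leaves is, up to the factor \<open>t - s\<close>, the distribution
  function of the density with parameter \<open>quot s t\<close>, by lemma \<open>leaf_primitive_diff\<close> below.\<close>

definition leaf_primitive :: "real \<Rightarrow> real \<Rightarrow> real" where
  "leaf_primitive s x = s * x + \<epsilon> s / (2 * pi) * sin (2 * pi * x)"

lemma leaf_primitive_derivative: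
  "(leaf_primitive s has_real_derivative leaf s x) (at x)"
  unfolding leaf_primitive_def leaf_def
  by (rule derivative_eq_intros refl | simp add: field_simps)+

lemma leaf_primitive_diff:
  "leaf_primitive t y - leaf_primitive s y = (t - s) * circle_primitive (quot s t) y" if "s \<noteq> t"
  using that by (simp add: leaf_primitive_def circle_primitive_def quot_def field_simps)

text \<open>Along the leaf the derivatives cancel: \<open>dS\<close> contributes \<open>R dX - r dx\<close>, and \<open>R\<close>, \<open>r\<close> are the heights
  of the leaf over \<open>X = leaf_map s x\<close> and over \<open>x\<close>. Here \<open>leaf_map s\<close> is differentiable because the
  leaf is a smooth graph.\<close>

lemma action_constant_on_leaf:
  assumes S: "\<And>x r. (S has_derivative (\<lambda>v. f2 (x, r) * snd v - r * fst v)) (at (x, f1 (x, r)))"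
  obtains A where
    "\<And>s x. S (x, leaf_map s x) - leaf_primitive s (leaf_map s x) + leaf_primitive s x = A s"
proof -
  have "S (x, leaf_map s x) - leaf_primitive s (leaf_map s x) + leaf_primitive s x =
    S (0, leaf_map s 0) - leaf_primitive s (leaf_map s 0) + leaf_primitive s 0" for s x
  proof (rule DERIV_isconst_all[where f = "\<lambda>x. S (x, leaf_map s x)
        - leaf_primitive s (leaf_map s x) + leaf_primitive s x"], rule allI)
    fix x
    define l where "l = - \<epsilon> s * (2 * pi) * sin (2 * pi * x)"
    have l: "(leaf s has_real_derivative l) (at x)"
      unfolding leaf_def l_def by (auto intro!: derivative_eq_intros)
    define g where "g = a (x, leaf s x) + b (x, leaf s x) * l"
    have "((\<lambda>x. f1 (x, leaf s x)) has_derivative (\<lambda>h. g * h)) (at x)"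
      by (rule has_derivative_eq_rhs, rule has_derivative_compose[OF _ f1])
        (auto intro!: derivative_eq_intros l[unfolded has_field_derivative_def]
          simp: g_def algebra_simps)
    then have g: "(leaf_map s has_real_derivative g) (at x)"
      by (simp add: has_field_derivative_def leaf_map_def[abs_def])
    have "((\<lambda>x. S (x, leaf_map s x)) has_derivative
        (\<lambda>h. (leaf s (leaf_map s x) * g - leaf s x) * h)) (at x)"
      by (rule has_derivative_eq_rhs,
          rule has_derivative_compose[where f = "\<lambda>x. (x, leaf_map s x)", OF _ S[of x "leaf s x", folded leaf_map_def]])
        (auto intro!: derivative_eq_intros g[unfolded has_field_derivative_def]
          simp: leaf_invariant algebra_simps)
    then have "((\<lambda>x. S (x, leaf_map s x)) has_real_derivative
        leaf s (leaf_map s x) * g - leaf s x) (at x)"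
      by (simp add: has_field_derivative_def)
    then show "((\<lambda>x. S (x, leaf_map s x) - leaf_primitive s (leaf_map s x) + leaf_primitive s x)
        has_real_derivative 0) (at x)"
      by (auto intro!: derivative_eq_intros leaf_primitive_derivative
          DERIV_chain2[OF leaf_primitive_derivative g])
  qed
  then show ?thesis
    by (rule that[of "\<lambda>s. S (0, leaf_map s 0) - leaf_primitive s (leaf_map s 0)
      + leaf_primitive s 0"])
qed

text \<open>Compare the identities of \<open>action_constant_on_leaf\<close> for the leaves \<open>X n\<close> and \<open>Y n\<close> over the
  same \<open>x\<close>. The function \<open>r \<mapsto> S (x, f1 (x, r)) - leaf_primitive (X n) (f1 (x, r))\<close> has a
  critical point on the leaf \<open>X n\<close>, so moving \<open>r\<close> to the leaf \<open>Y n\<close> changes it by \<open>o(Y n - X n)\<close>.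
  What remains of \<open>A (Y n) - A (X n)\<close> is the variation of the difference of the two primitives. After
  division by \<open>Y n - X n\<close> the left-hand side is independent of \<open>x\<close>, hence so is the limit of the
  right-hand side.\<close>

lemma limit_density_invariant:
  assumes X: "X \<longlonglongrightarrow> s" and Y: "Y \<longlonglongrightarrow> s" and ne: "\<And>n::nat. X n \<noteq> Y n"
    and q: "(\<lambda>n. quot (X n) (Y n)) \<longlonglongrightarrow> e"
  obtains k where "\<And>x. circle_primitive e (leaf_map s x) - circle_primitive e x = k"
proof -
  obtain S where
    S: "\<And>x r. (S has_derivative (\<lambda>v. f2 (x, r) * snd v - r * fst v)) (at (x, f1 (x, r)))"
    using generating_function by blast
  obtain A where A:
    "\<And>s x. S (x, leaf_map s x) - leaf_primitive s (leaf_map s x) + leaf_primitive s x = A s"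
    using action_constant_on_leaf[OF S] by blast
  have lim: "(\<lambda>n. - (A (Y n) - A (X n)) / (Y n - X n)) \<longlonglongrightarrow>
      circle_primitive e (leaf_map s x) - circle_primitive e x" for x
  proof -
    define D where "D = (\<lambda>n r. (f2 (x, r) - leaf (X n) (f1 (x, r))) * b (x, r))"
    have "\<exists>z. \<bar>z - leaf (X n) x\<bar> \<le> \<bar>leaf (Y n) x - leaf (X n) x\<bar> \<and>
      (S (x, leaf_map (Y n) x) - leaf_primitive (X n) (leaf_map (Y n) x)) -
      (S (x, leaf_map (X n) x) - leaf_primitive (X n) (leaf_map (X n) x)) =
      D n z * (leaf (Y n) x - leaf (X n) x)" for n
    proof -
      have "((\<lambda>r. S (x, f1 (x, r))) has_derivative (\<lambda>h. (f2 (x, r) * b (x, r)) * h)) (at r)" for r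
        by (rule has_derivative_eq_rhs, rule has_derivative_compose[where f = "\<lambda>r. (x, f1 (x, r))", OF _ S[of x r]])
          (auto intro!: derivative_eq_intros vertical_derivative[unfolded has_field_derivative_def]
            simp: algebra_simps)
      then have "((\<lambda>r. S (x, f1 (x, r)) - leaf_primitive (X n) (f1 (x, r)))
          has_real_derivative D n r) (at r)" for r
        unfolding D_def left_diff_distrib has_field_derivative_def[symmetric]
        by (intro DERIV_diff DERIV_chain2[OF leaf_primitive_derivative vertical_derivative])
          (simp add: has_field_derivative_def)
      then show ?thesis
        unfolding leaf_map_def by (rule mvt_between) blast
    qed
    then obtain z where z: "\<And>n. \<bar>z n - leaf (X n) x\<bar> \<le> \<bar>leaf (Y n) x - leaf (X n) x\<bar>"
      and zD: "\<And>n. (S (x, leaf_map (Y n) x) - leaf_primitive (X n) (leaf_map (Y n) x)) -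
      (S (x, leaf_map (X n) x) - leaf_primitive (X n) (leaf_map (X n) x)) =
      D n (z n) * (leaf (Y n) x - leaf (X n) x)"
      by metis
    have lX: "(\<lambda>n. leaf (X n) x) \<longlonglongrightarrow> leaf s x" and lY: "(\<lambda>n. leaf (Y n) x) \<longlonglongrightarrow> leaf s x"
      by (intro leaf_tendsto X Y tendsto_const)+
    have "(\<lambda>n. \<bar>leaf (Y n) x - leaf (X n) x\<bar>) \<longlonglongrightarrow> \<bar>leaf s x - leaf s x\<bar>"
      by (intro tendsto_intros lX lY)
    then have bound: "(\<lambda>n. \<bar>leaf (Y n) x - leaf (X n) x\<bar>) \<longlonglongrightarrow> 0"
      by simp
    have "(\<lambda>n. z n - leaf (X n) x) \<longlonglongrightarrow> 0"
      by (rule Lim_null_comparison[OF _ bound]) (simp add: z)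
    from tendsto_add[OF this lX] have z_lim: "z \<longlonglongrightarrow> leaf s x"
      by simp
    have "(\<lambda>n. D n (z n)) \<longlonglongrightarrow>
        (f2 (x, leaf s x) - leaf s (f1 (x, leaf s x))) * b (x, leaf s x)"
      unfolding D_def
      by (intro tendsto_intros leaf_tendsto X z_lim tendsto_on_plane[OF cont_f1]
          tendsto_on_plane[OF cont_f2] tendsto_on_plane[OF cont(2)])
    then have D0: "(\<lambda>n. D n (z n)) \<longlonglongrightarrow> 0"
      by (simp add: leaf_invariant leaf_map_def)
    have "- (A (Y n) - A (X n)) / (Y n - X n) =
        circle_primitive (quot (X n) (Y n)) (leaf_map (Y n) x)
          - circle_primitive (quot (X n) (Y n)) x
          - D n (z n) * (1 + quot (X n) (Y n) * cos (2 * pi * x))" for n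
    proof -
      have "A (Y n) - A (X n) = D n (z n) * (leaf (Y n) x - leaf (X n) x)
         - (leaf_primitive (Y n) (leaf_map (Y n) x) - leaf_primitive (X n) (leaf_map (Y n) x))
         + (leaf_primitive (Y n) x - leaf_primitive (X n) x)"
        unfolding A[of x, symmetric] zD[symmetric] by simp
      then have "- (A (Y n) - A (X n)) = (Y n - X n) * (
         circle_primitive (quot (X n) (Y n)) (leaf_map (Y n) x)
          - circle_primitive (quot (X n) (Y n)) x
          - D n (z n) * (1 + quot (X n) (Y n) * cos (2 * pi * x)))"
        unfolding leaf_primitive_diff[OF ne] leaf_diff[OF ne] by (simp add: algebra_simps)
      then show ?thesis using ne[of n] by simp
    qed
    moreover have "(\<lambda>n. circle_primitive (quot (X n) (Y n)) (leaf_map (Y n) x)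
          - circle_primitive (quot (X n) (Y n)) x
          - D n (z n) * (1 + quot (X n) (Y n) * cos (2 * pi * x))) \<longlonglongrightarrow>
        circle_primitive e (leaf_map s x) - circle_primitive e x
          - 0 * (1 + e * cos (2 * pi * x))"
      by (intro tendsto_intros circle_primitive_tendsto leaf_map_tendsto D0 q Y)
    ultimately show ?thesis by simp
  qed
  show ?thesis
    by (rule that[of "circle_primitive e (leaf_map s 0) - circle_primitive e 0"])
      (rule LIMSEQ_unique[OF lim lim])
qed

section \<open>Differentiability of the amplitude\<close>

text \<open>The leaves that the annulus map fixes pointwise.\<close>

definition translation_leaf :: "real \<Rightarrow> bool" where
  "translation_leaf s \<longleftrightarrow> (\<exists>m::int. \<forall>x. leaf_map s x = x + of_int m)"

text \<open>Difference quotients are bounded, so it suffices that all their limits at \<open>s\<close> coincide. Two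
  different limits would provide two invariant densities, which only a translation leaf admits. Both
  points of the difference quotient vary: this strict differentiability makes the derivative
  continuous as well.\<close>

lemma strict_derivative:
  assumes s: "\<not> translation_leaf s"
  obtains e where "\<And>\<eta>. \<eta> > 0 \<Longrightarrow>
    \<exists>\<delta>>0. \<forall>t u. \<bar>t - s\<bar> < \<delta> \<longrightarrow> \<bar>u - s\<bar> < \<delta> \<longrightarrow> t \<noteq> u \<longrightarrow> \<bar>quot t u - e\<bar> < \<eta>"
proof -
  have subseq: "\<exists>r e. strict_mono r \<and> (\<lambda>n. quot (X (r n)) (Y (r n))) \<longlonglongrightarrow> e"
    if "\<And>n. X n \<noteq> Y n" for X Y :: "nat \<Rightarrow> real"
  proof -
    have "quot (X n) (Y n) \<in> {- L..L}" for n
      using quot_bound[OF that[of n]] by auto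
    then show ?thesis
      using seq_compactE[OF compact_imp_seq_compact[OF compact_Icc], of "\<lambda>n. quot (X n) (Y n)"]
      unfolding o_def by metis
  qed
  have unique: "e1 = e2"
    if lims: "X \<longlonglongrightarrow> s" "Y \<longlonglongrightarrow> s" "\<And>n. X n \<noteq> Y n" "(\<lambda>n. quot (X n) (Y n)) \<longlonglongrightarrow> e1"
      "X' \<longlonglongrightarrow> s" "Y' \<longlonglongrightarrow> s" "\<And>n. X' n \<noteq> Y' n" "(\<lambda>n. quot (X' n) (Y' n)) \<longlonglongrightarrow> e2"
    for X Y X' Y' e1 e2
  proof (rule ccontr)
    assume "e1 \<noteq> e2"
    obtain k1 where k1: "\<And>x. circle_primitive e1 (leaf_map s x) - circle_primitive e1 x = k1"
      using limit_density_invariant[OF lims(1-4)] by blast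
    obtain k2 where k2: "\<And>x. circle_primitive e2 (leaf_map s x) - circle_primitive e2 x = k2"
      using limit_density_invariant[OF lims(5-8)] by blast
    obtain m :: int where "\<And>x. leaf_map s x = x + of_int m"
      using two_invariant_densities_imp_integer_translation[OF k1 k2 \<open>e1 \<noteq> e2\<close>] by blast
    then show False
      using s unfolding translation_leaf_def by blast
  qed
  define h where "h = (\<lambda>n. inverse (real (Suc n)))"
  have h: "h \<longlonglongrightarrow> 0" "\<And>n. h n > 0"
    using LIMSEQ_inverse_real_of_nat by (auto simp: h_def)
  obtain r e where r: "strict_mono r" and e: "(\<lambda>n. quot s (s + h (r n))) \<longlonglongrightarrow> e"
    using subseq[of "\<lambda>n. s" "\<lambda>n. s + h n"] h(2) by (metis add_cancel_left_right less_irrefl)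
  have hr: "(\<lambda>n. s + h (r n)) \<longlonglongrightarrow> s"
    using tendsto_add[OF tendsto_const[of s] LIMSEQ_subseq_LIMSEQ[OF h(1) r]] by (simp add: o_def)
  show ?thesis
  proof (rule that[of e], rule ccontr)
    fix \<eta> :: real assume "\<eta> > 0" and
      "\<not> (\<exists>\<delta>>0. \<forall>t u. \<bar>t - s\<bar> < \<delta> \<longrightarrow> \<bar>u - s\<bar> < \<delta> \<longrightarrow> t \<noteq> u \<longrightarrow> \<bar>quot t u - e\<bar> < \<eta>)"
    then have "\<exists>t u. \<bar>t - s\<bar> < h n \<and> \<bar>u - s\<bar> < h n \<and> t \<noteq> u \<and> \<eta> \<le> \<bar>quot t u - e\<bar>" for n
      using h(2)[of n] by (meson not_less)
    then obtain X Y where X: "\<And>n. \<bar>X n - s\<bar> < h n" and Y: "\<And>n. \<bar>Y n - s\<bar> < h n"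
      and ne: "\<And>n. X n \<noteq> Y n" and far: "\<And>n. \<eta> \<le> \<bar>quot (X n) (Y n) - e\<bar>"
      by metis
    have "(\<lambda>n. X n - s) \<longlonglongrightarrow> 0" "(\<lambda>n. Y n - s) \<longlonglongrightarrow> 0"
      by (rule Lim_null_comparison[OF _ h(1)], simp add: X Y less_imp_le)+
    then have lim: "X \<longlonglongrightarrow> s" "Y \<longlonglongrightarrow> s"
      by (simp_all add: LIM_zero_cancel)
    obtain r' e' where r': "strict_mono r'" and e': "(\<lambda>n. quot (X (r' n)) (Y (r' n))) \<longlonglongrightarrow> e'"
      using subseq[of X Y, OF ne] by blast
    have "e = e'"
      by (rule unique[OF tendsto_const hr _ e
            LIMSEQ_subseq_LIMSEQ[OF lim(1) r', unfolded o_def]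
            LIMSEQ_subseq_LIMSEQ[OF lim(2) r', unfolded o_def] ne e'])
        (metis add_cancel_left_right h(2) less_irrefl)
    have "(\<lambda>n. \<bar>quot (X (r' n)) (Y (r' n)) - e\<bar>) \<longlonglongrightarrow> \<bar>e' - e\<bar>"
      by (intro tendsto_intros e')
    then have "\<eta> \<le> \<bar>e' - e\<bar>"
      by (rule LIMSEQ_le_const) (use far in auto)
    with \<open>\<eta> > 0\<close> \<open>e = e'\<close> show False by simp
  qed
qed

lemma has_derivative_iff_quot:
  "(\<epsilon> has_real_derivative e) (at s) \<longleftrightarrow> ((\<lambda>t. quot s t) \<longlongrightarrow> e) (at s)"
  by (simp add: has_field_derivative_iff quot_def)

lemma non_translation_leaf_derivative:
  assumes s: "\<not> translation_leaf s"
  shows "(\<epsilon> has_real_derivative deriv \<epsilon> s) (at s)"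
    and "\<exists>k. \<forall>x. circle_primitive (deriv \<epsilon> s) (leaf_map s x) - circle_primitive (deriv \<epsilon> s) x = k"
    and "(\<And>t. \<epsilon> differentiable at t) \<Longrightarrow> (deriv \<epsilon> \<longlongrightarrow> deriv \<epsilon> s) (at s)"
proof -
  obtain e where e: "\<And>\<eta>. \<eta> > 0 \<Longrightarrow>
    \<exists>\<delta>>0. \<forall>t u. \<bar>t - s\<bar> < \<delta> \<longrightarrow> \<bar>u - s\<bar> < \<delta> \<longrightarrow> t \<noteq> u \<longrightarrow> \<bar>quot t u - e\<bar> < \<eta>"
    by (rule strict_derivative[OF s]) blast
  have lim: "((\<lambda>t. quot s t) \<longlongrightarrow> e) (at s)"
  proof (rule tendstoI)
    fix \<eta> :: real assume "\<eta> > 0"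
    from e[OF this] obtain \<delta> where "\<delta> > 0"
      "\<And>t u. \<bar>t - s\<bar> < \<delta> \<Longrightarrow> \<bar>u - s\<bar> < \<delta> \<Longrightarrow> t \<noteq> u \<Longrightarrow> \<bar>quot t u - e\<bar> < \<eta>"
      by blast
    then show "\<forall>\<^sub>F t in at s. dist (quot s t) e < \<eta>"
      unfolding eventually_at dist_real_def by (intro exI[of _ \<delta>]) auto
  qed
  then have "(\<epsilon> has_real_derivative e) (at s)"
    by (simp add: has_derivative_iff_quot)
  then have de: "deriv \<epsilon> s = e"
    by (rule DERIV_imp_deriv)
  show "(\<epsilon> has_real_derivative deriv \<epsilon> s) (at s)"
    unfolding de by fact
  define Y where "Y = (\<lambda>n. s + inverse (real (Suc n)))"
  have Y: "Y \<longlonglongrightarrow> s" "\<And>n. s \<noteq> Y n"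
    using LIMSEQ_inverse_real_of_nat_add[of s] by (auto simp: Y_def)
  then have "(\<lambda>n. quot s (Y n)) \<longlonglongrightarrow> e"
    by (intro filterlim_compose[OF lim]) (auto simp: filterlim_at eventually_sequentially)
  from limit_density_invariant[OF tendsto_const Y this]
  show "\<exists>k. \<forall>x. circle_primitive (deriv \<epsilon> s) (leaf_map s x) - circle_primitive (deriv \<epsilon> s) x = k"
    unfolding de by blast
  show "(deriv \<epsilon> \<longlongrightarrow> deriv \<epsilon> s) (at s)" if diff: "\<And>t. \<epsilon> differentiable at t"
    unfolding de
  proof (rule tendstoI)
    fix \<eta> :: real assume "\<eta> > 0"
    then obtain \<delta> where "\<delta> > 0" and \<delta>:
      "\<And>t u. \<bar>t - s\<bar> < \<delta> \<Longrightarrow> \<bar>u - s\<bar> < \<delta> \<Longrightarrow> t \<noteq> u \<Longrightarrow> \<bar>quot t u - e\<bar> < \<eta> / 2"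
      using e[of "\<eta> / 2"] by auto
    have "\<bar>deriv \<epsilon> t - e\<bar> \<le> \<eta> / 2" if t: "\<bar>t - s\<bar> < \<delta>" for t
    proof (rule tendsto_upperbound)
      have "((\<lambda>u. quot t u) \<longlongrightarrow> deriv \<epsilon> t) (at t)"
        using diff[of t] has_derivative_iff_quot
        by (meson DERIV_deriv_iff_real_differentiable)
      then show "((\<lambda>u. \<bar>quot t u - e\<bar>) \<longlongrightarrow> \<bar>deriv \<epsilon> t - e\<bar>) (at t)"
        by (intro tendsto_intros)
      have "\<forall>\<^sub>F u in at t. \<bar>u - s\<bar> < \<delta>"
        by (rule order_tendstoD[where y = "\<bar>t - s\<bar>"]) (intro tendsto_intros t)+
      then show "\<forall>\<^sub>F u in at t. \<bar>quot t u - e\<bar> \<le> \<eta> / 2"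
        using eventually_neq_at_within[of t t UNIV]
        by eventually_elim (use \<delta> t less_imp_le in metis)
    qed simp
    then show "\<forall>\<^sub>F t in at s. dist (deriv \<epsilon> t) e < \<eta>"
      unfolding eventually_at dist_real_def using \<open>\<delta> > 0\<close> \<open>\<eta> > 0\<close>
      by (intro exI[of _ \<delta>]) fastforce
  qed
qed

lemma leaf_map_continuous: "((\<lambda>t. leaf_map t x) \<longlongrightarrow> leaf_map s x) (at s)"
  by (intro leaf_map_tendsto tendsto_ident_at)

text \<open>By the twist condition \<open>leaf_map t 0\<close> is strictly monotone in \<open>t\<close>, and it is an integer on every
  translation leaf.\<close>

lemma translation_leaves_isolated:
  assumes m: "\<And>x. leaf_map s x = x + of_int m"
  shows "\<forall>\<^sub>F t in at s. \<not> translation_leaf t"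
proof -
  have lim: "((\<lambda>t. leaf_map t 0) \<longlongrightarrow> of_int m) (at s)"
    using leaf_map_continuous[of 0 s] m[of 0] by simp
  have "\<forall>\<^sub>F t in at s. leaf_map t 0 < of_int m + 1"
    by (rule order_tendstoD[OF lim]) simp
  moreover have "\<forall>\<^sub>F t in at s. of_int m - 1 < leaf_map t 0"
    by (rule order_tendstoD[OF lim]) simp
  ultimately show ?thesis
    using eventually_neq_at_within[of s s UNIV]
  proof eventually_elim
    case (elim t)
    show ?case
    proof
      assume "translation_leaf t"
      then obtain m' :: int where m': "leaf_map t 0 = of_int m'"
        unfolding translation_leaf_def by auto
      then have "m' = m"
        using elim by linarith
      then have "leaf_map t 0 = leaf_map s 0"
        using m[of 0] m' by simp
      then show False
        using leaf_map_strict_mono[of s t 0] leaf_map_strict_mono[of t s 0] elim by force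
    qed
  qed
qed

text \<open>On a leaf \<open>t\<close> near \<open>s\<close> the angle moves by \<open>m\<close> plus a small displacement \<open>\<Delta>\<close>. To first order
  \<open>\<Delta>\<close> is the twist \<open>b\<close> times the vertical distance \<open>(t - s) * (1 + quot s t * cos (2 * pi * x))\<close> of
  the leaves, and the measure with density \<open>1 + deriv \<epsilon> t * cos (2 * pi * x)\<close> of the short interval
  swept out does not depend on \<open>x\<close>. The flux \<open>\<kappa> t\<close> is this measure divided by \<open>t - s\<close>. The
  amplitude is not yet known to have a derivative at \<open>s\<close>, so the statement only asserts that a
  difference tends to zero.\<close>

lemma translation_leaf_flux:
  assumes m: "\<And>x. leaf_map s x = x + of_int m"
  obtains \<kappa> where "\<And>x. ((\<lambda>t. (1 + quot s t * cos (2 * pi * x)) *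
      (1 + deriv \<epsilon> t * cos (2 * pi * x)) * b (x, leaf s x) - \<kappa> t) \<longlongrightarrow> 0) (at s)"
proof
  define \<kappa> where "\<kappa> = (\<lambda>t. (circle_primitive (deriv \<epsilon> t) (leaf_map t 0)
      - circle_primitive (deriv \<epsilon> t) 0 - of_int m) / (t - s))"
  show "((\<lambda>t. (1 + quot s t * cos (2 * pi * x)) *
      (1 + deriv \<epsilon> t * cos (2 * pi * x)) * b (x, leaf s x) - \<kappa> t) \<longlongrightarrow> 0) (at s)" for x
  proof -
    define C where "C = cos (2 * pi * x)"
    define B where "B = b (x, leaf s x)"
    \<comment> \<open>\<open>\<tau>\<close> and \<open>\<sigma>\<close> are the exact difference quotients of the twist and of the distribution
      function, so that \<open>\<kappa> t = \<tau> t * (1 + quot s t * C) * (1 + deriv \<epsilon> t * \<sigma> t)\<close>.\<close>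
    define \<tau> where "\<tau> = (\<lambda>t. (leaf_map t x - (x + of_int m)) / (leaf t x - leaf s x))"
    define \<sigma> where "\<sigma> = (\<lambda>t. (sin (2 * pi * leaf_map t x) / (2 * pi)
        - sin (2 * pi * (x + of_int m)) / (2 * pi)) / (leaf_map t x - (x + of_int m)))"
    have leaf_ne: "leaf t x \<noteq> leaf s x" if "t \<noteq> s" for t
      using leaf_strict_mono[of s t x] leaf_strict_mono[of t s x] that by force
    have map_ne: "leaf_map t x \<noteq> x + of_int m" if "t \<noteq> s" for t
      using leaf_map_strict_mono[of s t x] leaf_map_strict_mono[of t s x] that m[of x] by force
    have "filterlim (\<lambda>t. leaf t x) (at (leaf s x)) (at s)"
      unfolding filterlim_at
      using leaf_ne
      by (auto simp: eventually_at_filter intro!: leaf_tendsto tendsto_ident_at tendsto_const)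
    from filterlim_compose[OF vertical_derivative[of x "leaf s x", unfolded has_field_derivative_iff] this]
    have \<tau>: "(\<tau> \<longlongrightarrow> B) (at s)"
      unfolding \<tau>_def B_def using m[of x] by (simp add: leaf_map_def)
    have lim_map: "filterlim (\<lambda>t. leaf_map t x) (at (x + of_int m)) (at s)"
      unfolding filterlim_at
      using leaf_map_continuous[of x s] m[of x] map_ne
      by (auto simp: eventually_at_filter)
    have "((\<lambda>y. sin (2 * pi * y) / (2 * pi)) has_real_derivative cos (2 * pi * (x + of_int m)))
        (at (x + of_int m))"
      by (auto intro!: derivative_eq_intros)
    from filterlim_compose[OF this[unfolded has_field_derivative_iff] lim_map]
    have "(\<sigma> \<longlongrightarrow> cos (2 * pi * (x + of_int m))) (at s)"
      unfolding \<sigma>_def .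
    moreover have "cos (2 * pi * (x + of_int m)) = C"
      unfolding C_def distrib_left cos_add by (simp add: cos_int_2pin sin_int_2pin)
    ultimately have \<sigma>: "(\<sigma> \<longlongrightarrow> C) (at s)"
      by simp
    have "((\<lambda>t. 2 * (\<bar>B - \<tau> t\<bar> + \<bar>C * B - \<tau> t * \<sigma> t\<bar>)) \<longlongrightarrow> 2 * (\<bar>B - B\<bar> + \<bar>C * B - B * C\<bar>)) (at s)"
      by (intro tendsto_intros \<tau> \<sigma>)
    then have bound: "((\<lambda>t. 2 * (\<bar>B - \<tau> t\<bar> + \<bar>C * B - \<tau> t * \<sigma> t\<bar>)) \<longlongrightarrow> 0) (at s)"
      by simp
    have "\<forall>\<^sub>F t in at s. \<bar>(1 + quot s t * C) * (1 + deriv \<epsilon> t * C) * B - \<kappa> t\<bar>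
        \<le> 2 * (\<bar>B - \<tau> t\<bar> + \<bar>C * B - \<tau> t * \<sigma> t\<bar>)"
      using translation_leaves_isolated[OF m] eventually_neq_at_within[of s s UNIV]
    proof eventually_elim
      case (elim t)
      let ?e = "deriv \<epsilon> t" and ?q = "quot s t"
      have "\<bar>?e\<bar> \<le> L"
      proof (rule tendsto_upperbound)
        show "((\<lambda>u. \<bar>quot t u\<bar>) \<longlongrightarrow> \<bar>?e\<bar>) (at t)"
          using non_translation_leaf_derivative(1)[OF elim(1)]
          by (intro tendsto_intros) (simp add: has_derivative_iff_quot)
        show "\<forall>\<^sub>F u in at t. \<bar>quot t u\<bar> \<le> L"
          using eventually_neq_at_within[of t t UNIV]
          by eventually_elim (simp add: quot_bound)
      qed simp
      then have e1: "\<bar>?e\<bar> \<le> 1"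
        using L1 by simp
      have q1: "\<bar>1 + ?q * C\<bar> \<le> 2"
        using quot_cos_less_1[of s t x] elim(2) by (simp add: C_def)
      obtain k where k: "\<And>y. circle_primitive ?e (leaf_map t y) - circle_primitive ?e y = k"
        using non_translation_leaf_derivative(2)[OF elim(1)] by blast
      define \<Delta> where "\<Delta> = leaf_map t x - (x + of_int m)"
      have "\<Delta> \<noteq> 0"
        using map_ne[OF elim(2)] by (simp add: \<Delta>_def)
      have sx: "sin (2 * pi * (x + of_int m)) = sin (2 * pi * x)"
        unfolding distrib_left sin_add by (simp add: cos_int_2pin sin_int_2pin)
      have "\<Delta> * \<sigma> t = (sin (2 * pi * leaf_map t x) - sin (2 * pi * x)) / (2 * pi)"
        using \<open>\<Delta> \<noteq> 0\<close> unfolding \<sigma>_def sx \<Delta>_def[symmetric] by (simp flip: diff_divide_distrib)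
      then have "\<Delta> * (1 + ?e * \<sigma> t)
          = circle_primitive ?e (leaf_map t x) - circle_primitive ?e x - of_int m"
        unfolding circle_primitive_def distrib_left mult.left_commute[of \<Delta>]
        by (simp add: \<Delta>_def right_diff_distrib diff_divide_distrib)
      also have "\<dots> = circle_primitive ?e (leaf_map t 0) - circle_primitive ?e 0 - of_int m"
        unfolding k ..
      also have "\<dots> = \<kappa> t * (t - s)"
        using elim(2) by (simp add: \<kappa>_def)
      finally have "\<kappa> t * (t - s) = \<Delta> * (1 + ?e * \<sigma> t)" ..
      also have "\<Delta> = \<tau> t * (leaf t x - leaf s x)"
        using leaf_ne[OF elim(2)] by (simp add: \<tau>_def \<Delta>_def)
      also have "leaf t x - leaf s x = (t - s) * (1 + ?q * C)"
        using leaf_diff[of s t x] elim(2) by (simp add: C_def)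
      finally have "\<kappa> t * (t - s) = (\<tau> t * (1 + ?q * C) * (1 + ?e * \<sigma> t)) * (t - s)"
        by (simp add: mult_ac)
      then have "\<kappa> t = \<tau> t * (1 + ?q * C) * (1 + ?e * \<sigma> t)"
        using elim(2) by simp
      then have "\<bar>(1 + ?q * C) * (1 + ?e * C) * B - \<kappa> t\<bar>
          = \<bar>(1 + ?q * C) * ((B - \<tau> t) + ?e * (C * B - \<tau> t * \<sigma> t))\<bar>"
        by (simp add: algebra_simps)
      also have "\<dots> \<le> 2 * (\<bar>B - \<tau> t\<bar> + \<bar>C * B - \<tau> t * \<sigma> t\<bar>)"
        unfolding abs_mult[of "1 + ?q * C"]
      proof (intro mult_mono q1)
        have "\<bar>?e * (C * B - \<tau> t * \<sigma> t)\<bar> \<le> 1 * \<bar>C * B - \<tau> t * \<sigma> t\<bar>"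
          unfolding abs_mult by (intro mult_right_mono e1) simp
        then show "\<bar>(B - \<tau> t) + ?e * (C * B - \<tau> t * \<sigma> t)\<bar> \<le> \<bar>B - \<tau> t\<bar> + \<bar>C * B - \<tau> t * \<sigma> t\<bar>"
          by (intro order_trans[OF abs_triangle_ineq]) simp
      qed auto
      finally show ?case .
    qed
    then have "((\<lambda>t. (1 + quot s t * C) * (1 + deriv \<epsilon> t * C) * B - \<kappa> t) \<longlongrightarrow> 0) (at s)"
      using bound by (auto intro: Lim_null_comparison)
    then show ?thesis
      unfolding C_def B_def .
  qed
qed

text \<open>The angles \<open>1/4\<close>, \<open>0\<close>, \<open>1/2\<close>, where the cosine is \<open>0\<close>, \<open>1\<close>, \<open>- 1\<close>, give in turn the limits of
  the flux, of \<open>(1 + q) * (1 + e)\<close> and of \<open>(1 - q) * (1 - e)\<close> for \<open>q = quot s t\<close> and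
  \<open>e = deriv \<epsilon> t\<close>. Half the difference of the last two is \<open>q + e\<close>. To separate \<open>q\<close> from \<open>e\<close>, note
  that \<open>q\<close> is \<open>(t - s) * (\<epsilon> t - \<epsilon> s)\<close> divided by \<open>(t - s)\<^sup>2\<close> and that the quotient of the derivatives
  of these functions is \<open>(q + e) / 2\<close>.\<close>

lemma translation_leaf_derivative:
  assumes m: "\<And>x. leaf_map s x = x + of_int m"
  obtains e where "(\<epsilon> has_real_derivative e) (at s)" "(deriv \<epsilon> \<longlongrightarrow> e) (at s)"
proof -
  obtain \<kappa> where flux: "\<And>x. ((\<lambda>t. (1 + quot s t * cos (2 * pi * x)) *
      (1 + deriv \<epsilon> t * cos (2 * pi * x)) * b (x, leaf s x) - \<kappa> t) \<longlongrightarrow> 0) (at s)"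
    using translation_leaf_flux[OF m] by blast
  define b0 where "b0 = b (0, leaf s 0)"
  define b1 where "b1 = b (1/4, leaf s (1/4))"
  define b2 where "b2 = b (1/2, leaf s (1/2))"
  have "((\<lambda>t. b1 - \<kappa> t) \<longlongrightarrow> 0) (at s)"
    using flux[of "1/4"] by (simp add: b1_def)
  from tendsto_diff[OF tendsto_const[of b1] this] have \<kappa>: "(\<kappa> \<longlongrightarrow> b1) (at s)"
    by simp
  have "((\<lambda>t. (((1 + quot s t) * (1 + deriv \<epsilon> t) * b0 - \<kappa> t) + \<kappa> t) / b0) \<longlongrightarrow> (0 + b1) / b0) (at s)"
    using flux[of 0] twist_nz by (intro tendsto_divide tendsto_add tendsto_const \<kappa>) (simp_all add: b0_def)
  then have plus: "((\<lambda>t. (1 + quot s t) * (1 + deriv \<epsilon> t)) \<longlongrightarrow> b1 / b0) (at s)"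
    using twist_nz by (simp add: b0_def)
  have "((\<lambda>t. (((1 - quot s t) * (1 - deriv \<epsilon> t) * b2 - \<kappa> t) + \<kappa> t) / b2) \<longlongrightarrow> (0 + b1) / b2) (at s)"
    using flux[of "1/2"] twist_nz by (intro tendsto_divide tendsto_add tendsto_const \<kappa>) (simp_all add: b2_def)
  then have minus: "((\<lambda>t. (1 - quot s t) * (1 - deriv \<epsilon> t)) \<longlongrightarrow> b1 / b2) (at s)"
    using twist_nz by (simp add: b2_def)
  define e where "e = (b1 / b0 - b1 / b2) / 4"
  have "((\<lambda>t. ((1 + quot s t) * (1 + deriv \<epsilon> t) - (1 - quot s t) * (1 - deriv \<epsilon> t)) / 2) \<longlongrightarrow>
      (b1 / b0 - b1 / b2) / 2) (at s)"
    by (intro tendsto_divide tendsto_diff plus minus tendsto_const) simp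
  moreover have "((1 + q) * (1 + r) - (1 - q) * (1 - r)) / 2 = q + r" for q r :: real
    by (simp add: field_simps)
  moreover have "(b1 / b0 - b1 / b2) / 2 = 2 * e"
    by (simp add: e_def mult.commute)
  ultimately have sum: "((\<lambda>t. quot s t + deriv \<epsilon> t) \<longlongrightarrow> 2 * e) (at s)"
    by (simp only:)
  have "((\<lambda>t. ((t - s) * (\<epsilon> t - \<epsilon> s)) / (t - s)\<^sup>2) \<longlongrightarrow> e) (at s)"
  proof (rule lhopital[where f' = "\<lambda>t. (\<epsilon> t - \<epsilon> s) + (t - s) * deriv \<epsilon> t" and g' = "\<lambda>t. 2 * (t - s)"])
    have "((\<lambda>t. (t - s) * (\<epsilon> t - \<epsilon> s)) \<longlongrightarrow> (s - s) * (\<epsilon> s - \<epsilon> s)) (at s)"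
      by (intro tendsto_intros cont_eps[unfolded isCont_def])
    then show "((\<lambda>t. (t - s) * (\<epsilon> t - \<epsilon> s)) \<longlongrightarrow> 0) (at s)"
      by simp
    have "((\<lambda>t. (t - s)\<^sup>2) \<longlongrightarrow> (s - s)\<^sup>2) (at s)"
      by (intro tendsto_intros)
    then show "((\<lambda>t. (t - s)\<^sup>2) \<longlongrightarrow> 0) (at s)"
      by simp
    show "\<forall>\<^sub>F t in at s. (t - s)\<^sup>2 \<noteq> 0" "\<forall>\<^sub>F t in at s. 2 * (t - s) \<noteq> 0"
      by (auto simp: eventually_at_filter)
    show "\<forall>\<^sub>F t in at s. ((\<lambda>t. (t - s) * (\<epsilon> t - \<epsilon> s)) has_real_derivative
        (\<epsilon> t - \<epsilon> s) + (t - s) * deriv \<epsilon> t) (at t)"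
      using translation_leaves_isolated[OF m]
    proof eventually_elim
      case (elim t)
      show ?case
        by (auto intro!: derivative_eq_intros non_translation_leaf_derivative(1)[OF elim])
    qed
    show "\<forall>\<^sub>F t in at s. ((\<lambda>t. (t - s)\<^sup>2) has_real_derivative 2 * (t - s)) (at t)"
      by (intro always_eventually allI) (auto intro!: derivative_eq_intros)
    have "((\<lambda>t. (quot s t + deriv \<epsilon> t) / 2) \<longlongrightarrow> (2 * e) / 2) (at s)"
      by (intro tendsto_divide sum tendsto_const) simp
    then have "((\<lambda>t. (quot s t + deriv \<epsilon> t) / 2) \<longlongrightarrow> e) (at s)"
      by simp
    then show "((\<lambda>t. ((\<epsilon> t - \<epsilon> s) + (t - s) * deriv \<epsilon> t) / (2 * (t - s))) \<longlongrightarrow> e) (at s)"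
      by (rule Lim_transform_eventually)
        (auto simp: eventually_at_filter quot_def field_simps)
  qed
  then have quot: "((\<lambda>t. quot s t) \<longlongrightarrow> e) (at s)"
    by (rule Lim_transform_eventually)
      (auto simp: eventually_at_filter quot_def power2_eq_square)
  show ?thesis
  proof (rule that)
    show "(\<epsilon> has_real_derivative e) (at s)"
      using quot by (simp add: has_derivative_iff_quot)
    show "(deriv \<epsilon> \<longlongrightarrow> e) (at s)"
      using tendsto_diff[OF sum quot] by simp
  qed
qed

lemma amplitude_C1: "\<epsilon> C1_differentiable_on UNIV"
proof -
  have D: "(\<epsilon> has_real_derivative deriv \<epsilon> s) (at s)" for s
  proof (cases "translation_leaf s")
    case True
    then show ?thesis
      unfolding translation_leaf_def using translation_leaf_derivative DERIV_imp_deriv by metis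
  qed (rule non_translation_leaf_derivative)
  then have diff: "\<epsilon> differentiable at s" for s
    by (meson real_differentiable_def)
  have "(deriv \<epsilon> \<longlongrightarrow> deriv \<epsilon> s) (at s)" for s
  proof (cases "translation_leaf s")
    case True
    then show ?thesis
      unfolding translation_leaf_def using translation_leaf_derivative DERIV_imp_deriv by metis
  qed (rule non_translation_leaf_derivative(3)[OF _ diff])
  then have "continuous_on UNIV (deriv \<epsilon>)"
    by (simp add: continuous_on_eq_continuous_at isCont_def)
  then show ?thesis
    unfolding C1_differentiable_on_def
    using D has_real_derivative_iff_has_vector_derivative by blast
qed

end

section \<open>From the annulus to its universal cover\<close>
lemma C1_diffeo_derivative_nonzero:
  assumes g: "increasing_C1_diffeo g" and D: "(g has_real_derivative D) (at r)"
  shows "D \<noteq> 0"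
proof -
  have "inv g differentiable at (g r)"
    using g unfolding increasing_C1_diffeo_def C1_differentiable_on_eq by blast
  then obtain D' where "(inv g has_real_derivative D') (at (g r))"
    by (auto simp: real_differentiable_def)
  from DERIV_chain2[OF this D] have "((\<lambda>r. inv g (g r)) has_real_derivative D' * D) (at r)" .
  moreover have "inv g (g r) = r" for r
    using g unfolding increasing_C1_diffeo_def by (simp add: bij_is_inj)
  ultimately have "D' * D = 1"
    using DERIV_unique DERIV_ident by (metis (no_types, lifting) ext)
  then show ?thesis by auto
qed

text \<open>The twist \<open>b\<close> does not vanish because the inverse of \<open>r \<mapsto> fst (F (x, r))\<close> is differentiable
  too.\<close>

lemma symplectic_twist_lift:
  assumes f: "symplectic_twist_diffeo f"
  obtains F a b c d where "is_lift F f"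
    "area_preserving_twist (\<lambda>p. fst (F p)) (\<lambda>p. snd (F p)) a b c d"
proof -
  obtain F F' where lift: "is_lift F f"
    and F': "\<And>p. (F has_derivative blinfun_apply (F' p)) (at p)"
    and cont: "continuous_on UNIV F'"
    using f unfolding symplectic_twist_diffeo_def annulus_C1_diffeo_def annulus_C1_def C1_map_def
    by blast
  define a where "a = (\<lambda>p. fst (blinfun_apply (F' p) (1, 0)))"
  define b where "b = (\<lambda>p. fst (blinfun_apply (F' p) (0, 1)))"
  define c where "c = (\<lambda>p. snd (blinfun_apply (F' p) (1, 0)))"
  define d where "d = (\<lambda>p. snd (blinfun_apply (F' p) (0, 1)))"
  have split: "blinfun_apply (F' p) v
      = fst v *\<^sub>R blinfun_apply (F' p) (1, 0) + snd v *\<^sub>R blinfun_apply (F' p) (0, 1)" for p v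
    by (cases v) (simp flip: blinfun.scaleR_right blinfun.add_right)
  have twist: "increasing_C1_diffeo (\<lambda>r. fst (F (x, r)))" for x
    using f lift unfolding symplectic_twist_diffeo_def twist_property_def by blast
  have f1: "((\<lambda>p. fst (F p)) has_derivative (\<lambda>v. a p * fst v + b p * snd v)) (at p)" for p
    using has_derivative_fst[OF F'[of p]]
    by (rule has_derivative_eq_rhs) (subst split, simp add: a_def b_def mult.commute)
  have "area_preserving_twist (\<lambda>p. fst (F p)) (\<lambda>p. snd (F p)) a b c d"
  proof
    show "((\<lambda>p. fst (F p)) has_derivative (\<lambda>v. a p * fst v + b p * snd v)) (at p)" for p
      by (rule f1)
    show "((\<lambda>p. snd (F p)) has_derivative (\<lambda>v. c p * fst v + d p * snd v)) (at p)" for p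
      using has_derivative_snd[OF F'[of p]]
      by (rule has_derivative_eq_rhs) (subst split, simp add: c_def d_def mult.commute)
    show "continuous_on UNIV a" "continuous_on UNIV b" "continuous_on UNIV c" "continuous_on UNIV d"
      unfolding a_def b_def c_def d_def by (intro continuous_intros cont)+
    have "omega (blinfun_apply (F' p) (1, 0)) (blinfun_apply (F' p) (0, 1)) = omega (1, 0) (0, 1)" for p
      using f lift F' unfolding symplectic_twist_diffeo_def preserves_omega_def by blast
    then show "a p * d p - b p * c p = 1" for p
      by (simp add: omega_def a_def b_def c_def d_def mult.commute)
    show "bij (\<lambda>r. fst (F (x, r)))" "strict_mono (\<lambda>r. fst (F (x, r)))" for x
      using twist[of x] by (simp_all add: increasing_C1_diffeo_def)
    have "((\<lambda>r. fst (F (x, r))) has_real_derivative b (x, r)) (at r)" for x r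
      unfolding has_field_derivative_def
      by (rule has_derivative_eq_rhs, rule has_derivative_compose[where f = "\<lambda>r. (x, r)", OF _ f1])
        (auto intro!: derivative_eq_intros)
    from C1_diffeo_derivative_nonzero[OF twist this]
    show "b p \<noteq> 0" for p
      by (cases p) auto
  qed
  with lift show ?thesis
    by (rule that)
qed

lemma invariant_cosine_foliation_imp_C1:
  assumes lip: "L-lipschitz_on UNIV \<epsilon>" and L: "L < 1"
    and f: "symplectic_twist_diffeo f"
    and inv: "invariant_foliation f (range (\<lambda>c. circle_graph (\<lambda>\<theta>. c + \<epsilon> c * circle_cos \<theta>)))"
  shows "\<epsilon> C1_differentiable_on UNIV"
proof -
  obtain F a b c d where lift: "is_lift F f"
    and twist: "area_preserving_twist (\<lambda>p. fst (F p)) (\<lambda>p. snd (F p)) a b c d"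
    by (rule symplectic_twist_lift[OF f])
  interpret area_preserving_twist "\<lambda>p. fst (F p)" "\<lambda>p. snd (F p)" a b c d
    by (rule twist)
  interpret invariant_cosine_leaves "\<lambda>p. fst (F p)" "\<lambda>p. snd (F p)" a b c d \<epsilon> L
  proof
    show "\<bar>\<epsilon> s - \<epsilon> t\<bar> \<le> L * \<bar>s - t\<bar>" for s t
      using lipschitz_onD[OF lip, of s t] by (simp add: dist_real_def)
    show "L < 1"
      by (rule L)
    show "let r = s + \<epsilon> s * cos (2 * pi * x) in
        snd (F (x, r)) = s + \<epsilon> s * cos (2 * pi * fst (F (x, r)))" for s x
    proof -
      let ?G = "circle_graph (\<lambda>\<theta>. s + \<epsilon> s * circle_cos \<theta>)"
      let ?p = "(x, s + \<epsilon> s * cos (2 * pi * x))"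
      have "to_annulus ?p \<in> ?G"
        by (simp add: to_annulus_def circle_graph_def circle_cos.abs_eq)
      then have "f (to_annulus ?p) \<in> ?G"
        using inv unfolding invariant_foliation_def by blast
      then have "to_annulus (F ?p) \<in> ?G"
        using lift by (simp add: is_lift_def)
      then show ?thesis
        by (simp add: to_annulus_def circle_graph_def circle_cos.abs_eq)
    qed
  qed
  show ?thesis
    by (rule amplitude_C1)
qed

section \<open>The foliation and its generating function\<close>
lemma to_circle_rep_circle: "to_circle (rep_circle \<theta>) = \<theta>"
  by (rule Quotient3_abs_rep[OF Quotient3_circle])

lemma to_circle_eq_iff: "to_circle x = to_circle y \<longleftrightarrow> x - y \<in> \<int>"
  by (simp add: circle.abs_eq_iff circle_rel_def)

lemma continuous_on_circle:
  fixes g :: "circle \<Rightarrow> 'a::topological_space"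
  assumes "continuous_on UNIV (\<lambda>t. g (to_circle t))"
  shows "continuous_on UNIV g"
  using assms unfolding continuous_on_open_vimage[OF open_UNIV]
  by (simp add: open_circle_def vimage_def)

lemma continuous_circle_cos: "continuous_on UNIV circle_cos"
  by (rule continuous_on_circle) (auto simp: circle_cos.abs_eq intro!: continuous_intros)

lemma continuous_circle_sin: "continuous_on UNIV circle_sin"
  by (rule continuous_on_circle) (auto simp: circle_sin.abs_eq intro!: continuous_intros)

lemma abs_circle_cos_le_1: "\<bar>circle_cos \<theta>\<bar> \<le> 1"
  using to_circle_rep_circle[of \<theta>] circle_cos.abs_eq[of "rep_circle \<theta>"]
  by (metis abs_cos_le_one)

text \<open>Over each angle the amplitude perturbs the identity by a contraction of ratio \<open>L\<close>. Banach's
  fixed point theorem solves for the leaf through a given point, and the expansion bound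
  \<open>(1 - L) * \<bar>s - t\<bar>\<close> for the distance of leaves makes the solution unique and jointly continuous in
  angle and height.\<close>

lemma cosine_graph_homeomorphism:
  fixes \<epsilon> :: "real \<Rightarrow> real"
  assumes lip: "L-lipschitz_on UNIV \<epsilon>" and L: "L < 1"
  shows "homeomorphic_map euclidean euclidean
     (\<lambda>(\<theta>, c). (\<theta>, c + \<epsilon> c * circle_cos \<theta>))"
proof -
  have L0: "0 \<le> L"
    using lip by (rule lipschitz_on_nonneg)
  have scaled: "\<bar>\<epsilon> s * k - \<epsilon> t * k\<bar> \<le> L * \<bar>s - t\<bar>" if "\<bar>k\<bar> \<le> 1" for s t k
  proof -
    have "\<bar>\<epsilon> s - \<epsilon> t\<bar> * \<bar>k\<bar> \<le> (L * \<bar>s - t\<bar>) * 1"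
      using lipschitz_onD[OF lip, of s t] that L0 by (intro mult_mono) (auto simp: dist_real_def)
    then show ?thesis
      by (simp add: abs_mult flip: left_diff_distrib)
  qed
  have expanding: "(1 - L) * \<bar>s - t\<bar> \<le> \<bar>(s + \<epsilon> s * k) - (t + \<epsilon> t * k)\<bar>" if "\<bar>k\<bar> \<le> 1" for s t k
  proof -
    have "\<bar>s - t\<bar> = \<bar>((s + \<epsilon> s * k) - (t + \<epsilon> t * k)) - (\<epsilon> s * k - \<epsilon> t * k)\<bar>"
      by simp
    also have "\<dots> \<le> \<bar>(s + \<epsilon> s * k) - (t + \<epsilon> t * k)\<bar> + L * \<bar>s - t\<bar>"
      using scaled[OF that, of s t] by (intro order_trans[OF abs_triangle_ineq4]) simp
    finally show ?thesis by (simp add: left_diff_distrib)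
  qed
  have "\<exists>c. c + \<epsilon> c * k = r" if "\<bar>k\<bar> \<le> 1" for k r
  proof -
    have "\<exists>!c. r - \<epsilon> c * k = c"
    proof (rule banach_fix_type[OF L0 L], intro allI)
      show "dist (r - \<epsilon> s * k) (r - \<epsilon> t * k) \<le> L * dist s t" for s t
        using scaled[OF that, of t s] by (simp add: dist_real_def abs_minus_commute)
    qed
    then show ?thesis by (metis diff_add_cancel)
  qed
  then obtain sol where sol: "\<And>k r. \<bar>k\<bar> \<le> 1 \<Longrightarrow> sol k r + \<epsilon> (sol k r) * k = r"
    by metis
  define \<psi> where "\<psi> = (\<lambda>p. sol (circle_cos (fst p)) (snd p))"
  have \<psi>: "\<psi> p + \<epsilon> (\<psi> p) * circle_cos (fst p) = snd p" for p
    unfolding \<psi>_def by (rule sol[OF abs_circle_cos_le_1])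
  have cont_cos: "continuous_on UNIV (\<lambda>p :: annulus. circle_cos (fst p))"
    by (rule continuous_on_compose2[OF continuous_circle_cos]) (auto intro: continuous_intros)
  have cont_eps: "continuous_on UNIV (\<lambda>p :: annulus. \<epsilon> (snd p))"
    by (rule continuous_on_compose2[OF lipschitz_on_continuous_on[OF lip]])
      (auto intro: continuous_intros)
  have "(\<psi> \<longlongrightarrow> \<psi> q) (at q)" for q
  proof -
    have "((\<lambda>p. \<bar>snd p - (\<psi> q + \<epsilon> (\<psi> q) * circle_cos (fst p))\<bar> / (1 - L)) \<longlongrightarrow>
        \<bar>snd q - (\<psi> q + \<epsilon> (\<psi> q) * circle_cos (fst q))\<bar> / (1 - L)) (at q)"
    proof -
      have "((\<lambda>p. circle_cos (fst p)) \<longlongrightarrow> circle_cos (fst q)) (at q)"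
        using cont_cos unfolding continuous_on_def by blast
      then show ?thesis
        using L by (intro tendsto_intros) auto
    qed
    then have bound: "((\<lambda>p. \<bar>snd p - (\<psi> q + \<epsilon> (\<psi> q) * circle_cos (fst p))\<bar> / (1 - L)) \<longlongrightarrow> 0) (at q)"
      by (simp add: \<psi>)
    have "norm (\<psi> p - \<psi> q) \<le> \<bar>snd p - (\<psi> q + \<epsilon> (\<psi> q) * circle_cos (fst p))\<bar> / (1 - L)" for p
      using expanding[OF abs_circle_cos_le_1, of "\<psi> p" "\<psi> q" "fst p"] L
      unfolding \<psi> by (simp add: field_simps)
    then have "((\<lambda>p. \<psi> p - \<psi> q) \<longlongrightarrow> 0) (at q)"
      by (intro Lim_null_comparison[OF always_eventually bound] allI)
    then show ?thesis
      by (rule LIM_zero_cancel)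
  qed
  then have cont_\<psi>: "continuous_on UNIV \<psi>"
    by (simp add: continuous_on_def)
  have "homeomorphic_maps euclidean euclidean
     (\<lambda>(\<theta>, c). (\<theta>, c + \<epsilon> c * circle_cos \<theta>)) (\<lambda>p. (fst p, \<psi> p))"
    unfolding homeomorphic_maps_def continuous_map_iff_continuous2
  proof (intro conjI ballI)
    show "continuous_on UNIV (\<lambda>(\<theta>, c). (\<theta>, c + \<epsilon> c * circle_cos \<theta>))"
      unfolding split_beta by (intro continuous_intros cont_cos cont_eps)
    show "continuous_on UNIV (\<lambda>p. (fst p, \<psi> p))"
      by (intro continuous_intros cont_\<psi>)
    fix p :: annulus
    obtain \<theta> c where p: "p = (\<theta>, c)"
      by (cases p)
    let ?d = "\<psi> (\<theta>, c + \<epsilon> c * circle_cos \<theta>)"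
    have "(1 - L) * \<bar>?d - c\<bar> \<le> 0"
      using expanding[OF abs_circle_cos_le_1, of ?d c \<theta>]
        \<psi>[of "(\<theta>, c + \<epsilon> c * circle_cos \<theta>)"] by simp
    then have "?d = c"
      using L by (simp add: mult_le_0_iff)
    then show "(fst (case p of (\<theta>, c) \<Rightarrow> (\<theta>, c + \<epsilon> c * circle_cos \<theta>)),
        \<psi> (case p of (\<theta>, c) \<Rightarrow> (\<theta>, c + \<epsilon> c * circle_cos \<theta>))) = p"
      by (simp add: p)
    show "(case (fst p, \<psi> p) of (\<theta>, c) \<Rightarrow> (\<theta>, c + \<epsilon> c * circle_cos \<theta>)) = p"
      using \<psi>[of p] by (simp add: p)
  qed
  then show ?thesis
    unfolding homeomorphic_map_maps by blast
qed

lemma cosine_leaf_mean: "circle_integral (\<lambda>\<theta>. c + e * circle_cos \<theta>) = c"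
proof -
  have "((\<lambda>t. c + e * cos (2 * pi * t)) has_integral
      (c * 1 + e / (2 * pi) * sin (2 * pi * 1)) - (c * 0 + e / (2 * pi) * sin (2 * pi * 0))) {0..1}"
    by (rule fundamental_theorem_of_calculus)
      (auto simp flip: has_real_derivative_iff_has_vector_derivative intro!: derivative_eq_intros)
  then show ?thesis
    by (simp add: circle_integral_def circle_cos.abs_eq integral_unique)
qed

text \<open>Smoothness of the leaves needs a class of functions that is closed under differentiation.\<close>

lemma trigonometric_iterated_deriv:
  fixes k a b :: real
  shows "(deriv ^^ n) (\<lambda>s. k + a * cos (2 * pi * s) + b * sin (2 * pi * s)) differentiable (at t)"
proof (induction n arbitrary: k a b)
  case 0
  have "((\<lambda>s. k + a * cos (2 * pi * s) + b * sin (2 * pi * s)) has_real_derivative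
      b * (2 * pi) * cos (2 * pi * t) - a * (2 * pi) * sin (2 * pi * t)) (at t)"
    by (auto intro!: derivative_eq_intros)
  then show ?case
    by (auto simp: real_differentiable_def)
next
  case (Suc n)
  have "deriv (\<lambda>s. k + a * cos (2 * pi * s) + b * sin (2 * pi * s)) =
      (\<lambda>s. 0 + (b * (2 * pi)) * cos (2 * pi * s) + (- a * (2 * pi)) * sin (2 * pi * s))"
    by (rule ext, rule DERIV_imp_deriv) (auto intro!: derivative_eq_intros)
  then show ?case
    by (simp only: funpow_Suc_right o_def Suc.IH)
qed

lemma cosine_leaf_smooth: "circle_smooth (\<lambda>\<theta>. c + e * circle_cos \<theta>)"
  using trigonometric_iterated_deriv[of _ c e 0]
  by (simp add: circle_smooth_def circle_cos.abs_eq)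

lemma cosine_C0_foliation:
  assumes lip: "L-lipschitz_on UNIV \<epsilon>" and L: "L < 1"
  shows "C0_foliation (range (\<lambda>c. circle_graph (\<lambda>\<theta>. c + \<epsilon> c * circle_cos \<theta>)))"
proof -
  let ?\<eta> = "\<lambda>c \<theta>. c + \<epsilon> c * circle_cos \<theta>"
  have homeo: "homeomorphic_map euclidean euclidean (\<lambda>(\<theta>, c). (\<theta>, ?\<eta> c \<theta>))"
    by (rule cosine_graph_homeomorphism[OF lip L])
  then have bij: "bij (\<lambda>(\<theta>, c). (\<theta>, ?\<eta> c \<theta>))"
    by (auto simp: homeomorphic_eq_everything_map bij_def)
  have on_leaf: "\<exists>c. r = ?\<eta> c \<theta>" for \<theta> r
  proof -
    have "(\<theta>, r) \<in> range (\<lambda>(\<theta>, c). (\<theta>, ?\<eta> c \<theta>))"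
      using bij_is_surj[OF bij] by simp
    then show ?thesis by auto
  qed
  have same_leaf: "c = c'" if "?\<eta> c \<theta> = ?\<eta> c' \<theta>" for c c' \<theta>
    using injD[OF bij_is_inj[OF bij], of "(\<theta>, c)" "(\<theta>, c')"] that by simp
  have "partition_on UNIV (range (\<lambda>c. circle_graph (?\<eta> c)))"
  proof (rule partition_onI)
    show "\<Union> (range (\<lambda>c. circle_graph (?\<eta> c))) = UNIV"
      unfolding circle_graph_def using on_leaf by fast
    show "disjnt p q" if "p \<in> range (\<lambda>c. circle_graph (?\<eta> c))"
      "q \<in> range (\<lambda>c. circle_graph (?\<eta> c))" "p \<noteq> q" for p q
      using that same_leaf unfolding circle_graph_def disjnt_iff by blast
    show "{} \<notin> range (\<lambda>c. circle_graph (?\<eta> c))"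
      unfolding circle_graph_def by blast
  qed
  moreover have "continuous_on UNIV (?\<eta> c)" for c
    by (intro continuous_intros continuous_circle_cos)
  ultimately show ?thesis
    unfolding C0_foliation_def using homeo cosine_leaf_mean by (intro conjI exI[of _ ?\<eta>]) auto
qed

text \<open>The derivative of a periodic function is periodic, so the representative that occurs in the
  definition of \<^const>\<open>circle_deriv\<close> can be replaced by any other.\<close>

lemma circle_deriv_to_circle:
  "circle_deriv g (to_circle t) = deriv (\<lambda>t. g (to_circle t)) t"
proof -
  define n where "n = rep_circle (to_circle t) - t"
  have "n \<in> \<int>"
    using to_circle_rep_circle[of "to_circle t"] by (simp add: to_circle_eq_iff n_def)
  then have "(\<lambda>t. g (to_circle (t + n))) = (\<lambda>t. g (to_circle t))"
    by (intro ext arg_cong[of _ _ g]) (simp add: to_circle_eq_iff)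
  then have "((\<lambda>t. g (to_circle t)) has_field_derivative D) (at (t + n)) \<longleftrightarrow>
      ((\<lambda>t. g (to_circle t)) has_field_derivative D) (at t)" for D
    by (simp add: DERIV_shift)
  then show ?thesis
    by (simp add: circle_deriv_def deriv_def n_def)
qed

text \<open>For uniqueness, the leaf that a generating function \<open>v\<close> assigns to \<open>c\<close> is the cosine leaf of some
  \<open>c'\<close>. Integrating, \<open>v\<close> is \<open>(c' - c) * t\<close> plus a periodic function of the angle \<open>t\<close>, so \<open>c' = c\<close>
  because \<open>v\<close> itself is periodic; the normalization at \<open>0\<close> then determines \<open>v\<close>.\<close>

lemma sine_generates_cosine_foliation:
  fixes \<epsilon> :: "real \<Rightarrow> real"
  assumes cont: "continuous_on UNIV \<epsilon>"
    and u: "\<And>\<theta> c. u (\<theta>, c) = \<epsilon> c / (2 * pi) * circle_sin \<theta>"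
  shows "is_generating_function u (range (\<lambda>c. circle_graph (\<lambda>\<theta>. c + \<epsilon> c * circle_cos \<theta>)))"
    (is "is_generating_function u ?\<F>")
  unfolding is_generating_function_def
proof (intro conjI allI impI)
  have deriv_u: "((\<lambda>t. u (to_circle t, c)) has_real_derivative \<epsilon> c * cos (2 * pi * t)) (at t)" for c t
    unfolding u circle_sin.abs_eq by (auto intro!: derivative_eq_intros)
  have "circle_deriv (\<lambda>\<phi>. u (\<phi>, c)) \<theta> = \<epsilon> c * circle_cos \<theta>" for c \<theta>
    using circle_deriv_to_circle[of "\<lambda>\<phi>. u (\<phi>, c)" "rep_circle \<theta>"]
      DERIV_imp_deriv[OF deriv_u, of c "rep_circle \<theta>"] circle_cos.abs_eq[of "rep_circle \<theta>"]
    by (simp add: to_circle_rep_circle)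
  moreover have "continuous_on UNIV u"
  proof -
    have "continuous_on UNIV (\<lambda>p. \<epsilon> (snd p) / (2 * pi) * circle_sin (fst p))"
      by (intro continuous_intros continuous_on_compose2[OF cont]
          continuous_on_compose2[OF continuous_circle_sin]) auto
    also have "(\<lambda>p. \<epsilon> (snd p) / (2 * pi) * circle_sin (fst p)) = u"
      using u by auto
    finally show ?thesis .
  qed
  moreover have "circle_C1 (\<lambda>\<theta>. u (\<theta>, c))" for c
    unfolding circle_C1_def C1_differentiable_on_def
    using deriv_u[of c]
    by (intro exI[of _ "\<lambda>t. \<epsilon> c * cos (2 * pi * t)"])
      (auto simp: has_real_derivative_iff_has_vector_derivative intro!: continuous_intros)
  ultimately show "generates_foliation u ?\<F>"
    unfolding generates_foliation_def by (auto simp: u circle_sin.abs_eq)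
next
  fix v assume v: "generates_foliation v ?\<F>"
  have "v (\<theta>, c) = u (\<theta>, c)" for \<theta> c
  proof -
    define w where "w = (\<lambda>t. v (to_circle t, c))"
    obtain c' where "circle_graph (\<lambda>\<theta>. c + circle_deriv (\<lambda>\<phi>. v (\<phi>, c)) \<theta>) =
        circle_graph (\<lambda>\<theta>. c' + \<epsilon> c' * circle_cos \<theta>)"
      using v unfolding generates_foliation_def by blast
    then have leaf: "c + circle_deriv (\<lambda>\<phi>. v (\<phi>, c)) \<theta> = c' + \<epsilon> c' * circle_cos \<theta>" for \<theta>
      unfolding circle_graph_def by blast
    have "w differentiable at t" for t
      using v unfolding generates_foliation_def circle_C1_def w_def C1_differentiable_on_eq by blast
    then have "(w has_real_derivative deriv w t) (at t)" for t
      by (simp add: DERIV_deriv_iff_real_differentiable)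
    moreover have "deriv w t = (c' - c) + \<epsilon> c' * cos (2 * pi * t)" for t
      using leaf[of "to_circle t"] circle_deriv_to_circle[of "\<lambda>\<phi>. v (\<phi>, c)" t]
      by (simp add: w_def circle_cos.abs_eq)
    ultimately have dw: "(w has_real_derivative (c' - c) + \<epsilon> c' * cos (2 * pi * t)) (at t)" for t
      by metis
    have w0: "w 0 = 0"
      using v by (simp add: generates_foliation_def w_def)
    have "w t - ((c' - c) * t + \<epsilon> c' / (2 * pi) * sin (2 * pi * t))
      = w 0 - ((c' - c) * 0 + \<epsilon> c' / (2 * pi) * sin (2 * pi * 0))" for t
      by (rule DERIV_isconst_all[where f = "\<lambda>t. w t - ((c' - c) * t + \<epsilon> c' / (2 * pi) * sin (2 * pi * t))"])
        (auto intro!: derivative_eq_intros dw)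
    then have w: "w t = (c' - c) * t + \<epsilon> c' / (2 * pi) * sin (2 * pi * t)" for t
      using w0 by simp
    have "to_circle 1 = to_circle 0"
      by (simp add: to_circle_eq_iff)
    then have "w 1 = w 0"
      by (simp add: w_def)
    then have "c' = c"
      using w[of 1] w0 by simp
    then show ?thesis
      using w[of "rep_circle \<theta>"] circle_sin.abs_eq[of "rep_circle \<theta>"]
      by (simp add: w_def to_circle_rep_circle u)
  qed
  then show "v = u"
    by auto
qed

theorem corollary1p1:
  fixes \<epsilon> :: "real \<Rightarrow> real"
    and \<eta> :: "real \<Rightarrow> circle \<Rightarrow> real"
    and \<F> :: "annulus set set"
    and u :: "annulus \<Rightarrow> real"
  assumes not_C1: "\<not> \<epsilon> C1_differentiable_on UNIV"
    and lipschitz: "(1 / (4 * pi))-lipschitz_on UNIV \<epsilon>"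
    and eta: "\<And>c \<theta>. \<eta> c \<theta> = c + \<epsilon> c * circle_cos \<theta>"
    and foliation: "\<F> = range (\<lambda>c. circle_graph (\<eta> c))"
    and u: "\<And>\<theta> c. u (\<theta>, c) = \<epsilon> c / (2 * pi) * circle_sin \<theta>"
  shows "C0_foliation \<F> \<and> (\<forall>c. circle_smooth (\<eta> c)) \<and>
    is_generating_function u \<F> \<and>
    \<not> (\<exists>f. symplectic_twist_diffeo f \<and> C0_integrable f \<and> invariant_foliation f \<F>)"
proof (intro conjI)
  let ?L = "1 / (4 * pi)"
  have L: "?L < 1"
    using pi_gt3 by simp
  have leaf: "\<eta> c = (\<lambda>\<theta>. c + \<epsilon> c * circle_cos \<theta>)" for c
    using eta by blast
  then have F: "\<F> = range (\<lambda>c. circle_graph (\<lambda>\<theta>. c + \<epsilon> c * circle_cos \<theta>))"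
    by (simp add: foliation)
  show "C0_foliation \<F>"
    unfolding F by (rule cosine_C0_foliation[OF lipschitz L])
  show "\<forall>c. circle_smooth (\<eta> c)"
    by (simp add: leaf cosine_leaf_smooth)
  show "is_generating_function u \<F>"
    unfolding F
    by (rule sine_generates_cosine_foliation[OF lipschitz_on_continuous_on[OF lipschitz] u])
  show "\<not> (\<exists>f. symplectic_twist_diffeo f \<and> C0_integrable f \<and> invariant_foliation f \<F>)"
    unfolding F using invariant_cosine_foliation_imp_C1[OF lipschitz L] not_C1 by blast
qed

end
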